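(* Let $\ell, k, n\in \mathbb N$ (positive integers) be such that $0<\ell \leq k/2$ and $k-\ell$ divides $n$. Let any $2$-edge-colouring of the complete $k$-uniform hypergraph $\mathcal K_n^{(k)}$ on $n$ vertices be given. (a) There are at most two vertex-disjoint monochromatic $\ell$-cycles, in different colours if there are two of them, together covering all but at most $4(k-\ell)$ vertices of $\mathcal K_n^{(k)}$. (b) If moreover $\ell \leq k/3$, then there are at most two vertex-disjoint monochromatic $\ell$-cycles, in different colours if there are two of them, together covering all but at most $2(k-\ell)$ vertices of $\mathcal K_n^{(k)}$.
   Context: $\mathcal K_n^{(k)}$ is the $k$-uniform hypergraph on $n$ vertices whose edges are all $k$-subsets of the vertex set; a $2$-edge-colouring assigns to each edge one of two colours (blue, red). An $\ell$-cycle is a $k$-uniform hypergraph with a cyclic ordering of its vertices and a cyclic ordering of its edges such that every edge consists of $k$ consecutive vertices and consecutive edges intersect in exactly $\ell$ vertices. Concretely, for $0<\ell\le k/2$ and $m\ge 3$, an $\ell$-cycle of length $m$ has $m(k-\ell)$ distinct vertices $v_0,\dots,v_{m(k-\ell)-1}$ and the $m$ edges $\{v_{i(k-\ell)},v_{i(k-\ell)+1},\dots,v_{i(k-\ell)+k-1}\}$, $0\le i<m$, indices modulo $m(k-\ell)$. By convention, two edges intersecting in exactly $2\ell$ vertices also form an $\ell$-cycle (of length two, with $2(k-\ell)$ vertices); when $\ell=k/2$ this means that a single edge, counted twice, is an $\ell$-cycle of length two. Also, any set of $k-\ell$ vertices counts as a (degenerate) $\ell$-cycle, with no edges. An $\ell$-cycle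 is monochromatic if all its edges have the same colour; a degenerate $\ell$-cycle is monochromatic and may be regarded as having either colour. An $\ell$-cycle covers the vertices it contains. *)

theory Defs
  imports Main "HOL-Library.Ramsey" "HOL-Library.Disjoint_Sets"
begin

datatype colour = Blue | Red

type_synonym 'a hypergraph = "'a set \<times> 'a set set"

abbreviation verts :: "'a hypergraph \<Rightarrow> 'a set" where "verts \<equiv> fst"
abbreviation edges :: "'a hypergraph \<Rightarrow> 'a set set" where "edges \<equiv> snd"

definition complete_hypergraph :: "nat \<Rightarrow> 'a set \<Rightarrow> 'a hypergraph" where
  "complete_hypergraph k V = (V, nsets V k)"

definition subhypergraph :: "'a hypergraph \<Rightarrow> 'a hypergraph \<Rightarrow> bool" where
  "subhypergraph H G \<longleftrightarrow> verts H \<subseteq> verts G \<and> edges H \<subseteq> edges G"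

definition degenerate_cycle :: "nat \<Rightarrow> nat \<Rightarrow> 'a hypergraph \<Rightarrow> bool" where
  "degenerate_cycle k l C \<longleftrightarrow> finite (verts C) \<and> card (verts C) = k - l \<and> edges C = {}"

text \<open>For \<open>l = k / 2\<close> the intersection condition below forces \<open>e = f\<close>:
  a single edge counted twice.\<close>

definition two_cycle :: "nat \<Rightarrow> nat \<Rightarrow> 'a hypergraph \<Rightarrow> bool" where
  "two_cycle k l C \<longleftrightarrow>
     (\<exists>e f. finite e \<and> finite f \<and> card e = k \<and> card f = k \<and> card (e \<inter> f) = 2 * l \<and>
            C = (e \<union> f, {e, f}))"

definition long_cycle :: "nat \<Rightarrow> nat \<Rightarrow> nat \<Rightarrow> 'a hypergraph \<Rightarrow> bool" where
  "long_cycle k l m C \<longleftrightarrow> m \<ge> 3 \<and>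
     (\<exists>v :: nat \<Rightarrow> 'a. inj_on v {..<m * (k - l)} \<and>
        verts C = v ` {..<m * (k - l)} \<and>
        edges C = (\<lambda>i. (\<lambda>j. v ((i * (k - l) + j) mod (m * (k - l)))) ` {..<k}) ` {..<m})"

text \<open>Intended for \<open>0 < l \<le> k / 2\<close> only.\<close>

definition l_cycle :: "nat \<Rightarrow> nat \<Rightarrow> 'a hypergraph \<Rightarrow> bool" where
  "l_cycle k l C \<longleftrightarrow>
     degenerate_cycle k l C \<or> two_cycle k l C \<or> (\<exists>m. long_cycle k l m C)"

text \<open>A degenerate cycle has no edges, so it is monochromatic in either colour.\<close>

definition monochromatic_in :: "('a set \<Rightarrow> colour) \<Rightarrow> colour \<Rightarrow> 'a hypergraph \<Rightarrow> bool" where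
  "monochromatic_in \<chi> c C \<longleftrightarrow> (\<forall>e \<in> edges C. \<chi> e = c)"

text \<open>At most two vertex-disjoint monochromatic \<open>l\<close>-cycles in the complete \<open>k\<close>-uniform
  hypergraph on \<open>V\<close>, of different colours if there are two, that together cover all but at
  most \<open>r\<close> vertices. Only the values of \<open>\<chi>\<close> on \<open>k\<close>-subsets of \<open>V\<close> matter; \<open>col\<close>
  selects the colour each cycle is regarded as having.\<close>

definition covered_by_two_cycles ::
    "nat \<Rightarrow> nat \<Rightarrow> 'a set \<Rightarrow> ('a set \<Rightarrow> colour) \<Rightarrow> nat \<Rightarrow> bool" where
  "covered_by_two_cycles k l V \<chi> r \<longleftrightarrow>
     (\<exists>(\<C> :: 'a hypergraph set) (col :: 'a hypergraph \<Rightarrow> colour).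
        finite \<C> \<and> card \<C> \<le> 2 \<and>
        (\<forall>C \<in> \<C>. l_cycle k l C \<and> subhypergraph C (complete_hypergraph k V) \<and>
                  monochromatic_in \<chi> (col C) C) \<and>
        disjoint_family_on verts \<C> \<and>
        inj_on col \<C> \<and>
        card (V - (\<Union>C \<in> \<C>. verts C)) \<le> r)"

end

theory Submission
  imports Defs
begin

text \<open>
  Measure everything in blocks of \<open>k - l\<close> vertices and suppose that no two cycles leave at most \<open>t\<close> blocks
  uncovered. As in Gyarfas' argument for graphs, a longest pair of disjoint monochromatic paths in different
  colours misses no joint; closing one of the two paths gives a blue cycle and a disjoint red path that
  together miss one block, and we take such a pair with the cycle as long as possible (over both colours).

  Maximality forbids inserting an end of the red path into the cycle. Hence of any two consecutive joints of
  the cycle one can be used to close the red path to a red cycle, and then every chord of the cycle that skips two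
  joints must be red, since otherwise the blue remainder closes up as well. Such chords (together with chords
  skipping three joints, or with joints chosen inside private sets when \<open>l \<le> p\<close>, if three divides the length
  of the cycle) form red paths through almost all of the cycle. Either one of them can be attached to both
  ends of the red path, or the colours at all joints are so rigid that even the chords skipping one joint
  are red, and then there is a red cycle through all joints.
\<close>

text \<open>The loss \<open>t\<close> decides which chords are available. If a blue chord from
  \<open>S i\<close> to \<open>S (i + m)\<close> closed the long arc of the cycle while a skipped
  joint is absorbed by the red path, the two cycles would have \<open>b + 1 - m\<close> and
  \<open>r + 1\<close> blocks, a loss of \<open>m - 1\<close>. With \<open>t = 2\<close> only
  \<open>m \<le> 3\<close> is affordable, and \<open>m = 2\<close> skips a single joint, whereas it
  is only known that one of two consecutive joints can be absorbed. So steps of three remain, and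
  they never leave a residue class when three divides \<open>b\<close>. This is the obstacle behind
  the two bounds: \<open>t \<ge> 3\<close> also pays for \<open>m = 4\<close>, while
  \<open>l \<le> p\<close> leaves room for a joint inside a private set.

  A path has one private set fewer than joints, so a cycle and a path missing one block leave
  \<open>l + 2 * p\<close> vertices free. The two disjoint private sets found there are the material
  for attaching both ends of the red path. The red paths through the cycle may omit one joint, since
  together with the missing block this is a loss of two; omitting it is what makes the shift between
  their ends even.\<close>

fun opp :: "colour \<Rightarrow> colour" where
  "opp Blue = Red"
| "opp Red = Blue"

lemma opp_opp [simp]: "opp (opp c) = c"
  by (cases c) auto

lemma opp_neq [simp]: "opp c \<noteq> c" "c \<noteq> opp c"
  by (cases c; simp)+

lemma not_opp_iff: "x \<noteq> opp c \<longleftrightarrow> x = c"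
  by (cases x; cases c) auto

lemma not_colour_iff: "x \<noteq> c \<longleftrightarrow> x = opp c"
  by (cases x; cases c) auto

section \<open>Sets of prescribed size\<close>

definition sized :: "nat \<Rightarrow> 'a set \<Rightarrow> bool" where
  "sized q X \<longleftrightarrow> finite X \<and> card X = q"

lemma sized_finite: "sized q X \<Longrightarrow> finite X"
  by (simp add: sized_def)

lemma sized_Un: "\<lbrakk>sized a X; sized b Y; X \<inter> Y = {}\<rbrakk> \<Longrightarrow> sized (a + b) (X \<union> Y)"
  by (auto simp: sized_def card_Un_disjoint)

lemma obtain_sized:
  assumes "finite F" "a \<le> card F"
  obtains X where "X \<subseteq> F" "sized a X"
  using obtain_subset_with_card_n[OF assms(2)] assms(1) finite_subset unfolding sized_def by metis

lemma obtain_sized2: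
  assumes "finite F" "a + b \<le> card F"
  obtains X Y where "X \<subseteq> F" "Y \<subseteq> F" "sized a X" "sized b Y" "X \<inter> Y = {}"
proof -
  obtain X where X: "X \<subseteq> F" "sized a X" by (rule obtain_sized[of F a]) (use assms in auto)
  have "card (F - X) = card F - a"
    using X assms by (simp add: sized_def card_Diff_subset)
  then obtain Y where "Y \<subseteq> F - X" "sized b Y"
    by (metis obtain_sized assms finite_Diff le_diff_conv2 add.commute add_leD1)
  then show thesis using X that by blast
qed

lemma obtain_sized3:
  assumes "finite F" "a + b + c \<le> card F"
  obtains X Y Z where "X \<subseteq> F" "Y \<subseteq> F" "Z \<subseteq> F" "sized a X" "sized b Y" "sized c Z"
    "X \<inter> Y = {}" "X \<inter> Z = {}" "Y \<inter> Z = {}"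
proof -
  obtain XY Z where 1: "XY \<subseteq> F" "Z \<subseteq> F" "sized (a + b) XY" "sized c Z" "XY \<inter> Z = {}"
    by (rule obtain_sized2[OF assms])
  obtain X Y where 2: "X \<subseteq> XY" "Y \<subseteq> XY" "sized a X" "sized b Y" "X \<inter> Y = {}"
    by (rule obtain_sized2[of XY a b]) (use 1 in \<open>auto simp: sized_def\<close>)
  show thesis by (rule that[of X Y Z]) (use 1 2 in auto)
qed

section \<open>Residues and periodic predicates\<close>

lemma mod_neq_of_lt:
  fixes x y :: int
  assumes "x \<noteq> y" "\<bar>x - y\<bar> < int b"
  shows "x mod int b \<noteq> y mod int b"
proof
  assume "x mod int b = y mod int b"
  then have "int b dvd x - y" by (simp add: mod_eq_dvd_iff)
  then show False using assms zdvd_imp_le[of "int b" "\<bar>x - y\<bar>"] by auto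
qed

text \<open>One round through the four implications leads from \<open>s\<close> to both
  \<open>s + 2 * h\<close> and \<open>s + 2 * h + 2\<close>. Taking the first outcome
  \<open>b - 1\<close> times and then the second gives a shift by \<open>2 * h * b + 2\<close>, from
  which the multiple of the period drops out.\<close>

lemma step_two_of_chain:
  fixes f g f' g' :: "int \<Rightarrow> bool"
  assumes "\<And>s. f s \<Longrightarrow> \<not> g (s + h)" "\<And>s. \<not> g s \<Longrightarrow> g' (s + 1)"
    "\<And>s. g' s \<Longrightarrow> \<not> f' (s + h)" "\<And>s. \<not> f' s \<Longrightarrow> f (s + 1) \<and> f (s - 1)"
    and period: "\<And>s. f (s + int b) = f s" and "0 < b" "f s"
  shows "f (s + 2)"
proof -
  have 1: "f (s + 2 * h) \<and> f (s + 2 * h + 2)" if "f s" for s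
    using assms(4)[OF assms(3)[OF assms(2)[OF assms(1)[OF that]]]] by (simp add: algebra_simps)
  have "f (s + 2 * h * int k)" for k
  proof (induction k)
    case (Suc k)
    then show ?case using 1[of "s + 2 * h * int k"] by (simp add: algebra_simps)
  qed (use assms in simp)
  from 1[OF this[of "b - 1"]] have *: "f (s + 2 + 2 * h * int b)"
    using assms(6) by (simp add: algebra_simps of_nat_diff)
  have "f (u + int b * int k) = f u" for u k
    by (induction k) (use period[of "u + int b * int _"] in \<open>auto simp: algebra_simps\<close>)
  then have up: "f (u + int b * x) = f u" if "0 \<le> x" for u x by (metis that nonneg_int_cases)
  have "f (u + int b * x) = f u" for u x
  proof (cases "0 \<le> x")
    case False
    then show ?thesis using up[of "- x" "u + int b * x"] by simp
  qed (use up in simp)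
  then show ?thesis using *[unfolded mult.commute[of _ "int b"]] by blast
qed

text \<open>Half of \<open>h\<close> may be negative. Adding a multiple of the period turns the
  shift into a nonnegative number of steps of two.\<close>

lemma shift_even_of_step_two:
  fixes f :: "int \<Rightarrow> bool"
  assumes "\<And>s. f s \<Longrightarrow> f (s + 2)" and period: "\<And>s. f (s + int b) = f s" and "0 < b" "even h" "f s"
  shows "f (s + h)"
proof -
  have step: "f (s + 2 * int k)" for k
    by (induction k) (use assms(1)[of "s + 2 * int _"] assms(5) in \<open>auto simp: algebra_simps\<close>)
  obtain e where e: "h = 2 * e" using assms(4) by auto
  have "f (u + int b * int k) = f u" for u k
    by (induction k) (use period[of "u + int b * int _"] in \<open>auto simp: algebra_simps\<close>)
  from this[of "s + h" "2 * nat \<bar>e\<bar>"]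
  have "f (s + h) = f (s + h + int b * (2 * \<bar>e\<bar>))" by simp
  moreover have "0 \<le> e + int b * \<bar>e\<bar>"
  proof -
    have "\<bar>e\<bar> \<le> int b * \<bar>e\<bar>" using assms(3) by (simp add: mult_le_cancel_right1)
    then show ?thesis by linarith
  qed
  then have "f (s + 2 * (e + int b * \<bar>e\<bar>))" using step[of "nat (e + int b * \<bar>e\<bar>)"] by simp
  moreover have "s + 2 * (e + int b * \<bar>e\<bar>) = s + h + int b * (2 * \<bar>e\<bar>)" by (simp add: e)
  ultimately show ?thesis by metis
qed

text \<open>Here \<open>f\<close> and \<open>g\<close> will say that a joint can be attached to the ends \<open>A\<close> and \<open>B\<close> of the red path by
  means of a private set \<open>Q\<close>, and \<open>f'\<close> and \<open>g'\<close> the same for a private set \<open>Q'\<close> disjoint from \<open>Q\<close>.\<close>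
lemma no_match:
  fixes f f' g g' :: "int \<Rightarrow> bool"
  assumes "\<And>s. f s \<Longrightarrow> \<not> g' (s + h)" "\<And>s. f' s \<Longrightarrow> \<not> g (s + h)"
    "\<And>s. g s \<Longrightarrow> \<not> f' (s + h)" "\<And>s. g' s \<Longrightarrow> \<not> f (s + h)"
    "\<And>s. \<not> f s \<Longrightarrow> f' (s + 1)" "\<And>s. \<not> f' s \<Longrightarrow> f (s + 1) \<and> f (s - 1)"
    "\<And>s. \<not> g s \<Longrightarrow> g' (s + 1) \<and> g' (s - 1)" "\<And>s. \<not> g' s \<Longrightarrow> g (s + 1)"
    and "\<And>s. f (s + int b) = f s" "\<And>s. g' (s + int b) = g' s" "0 < b" "even h"
  shows "\<not> (f s \<and> g' s)"
proof
  assume "f s \<and> g' s"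
  \<comment> \<open>The chain runs \<open>g'\<close>, not \<open>f\<close>, \<open>f'\<close>, not
    \<open>g\<close>, \<open>g'\<close>; the two-sided hypothesis on \<open>g\<close> provides the
    two outcomes at its end.\<close>
  have "g' (s + 2)" if "g' s" for s
    by (rule step_two_of_chain[of g' f h f' g]) (use assms that in auto)
  then have "g' (s + h)"
    by (rule shift_even_of_step_two) (use assms \<open>f s \<and> g' s\<close> in auto)
  then show False using assms(1) \<open>f s \<and> g' s\<close> by blast
qed

lemma dvd_of_dvd_three_times:
  fixes b x :: int
  assumes "\<not> 3 dvd b" "b dvd 3 * x"
  shows "b dvd x"
proof -
  obtain y where y: "3 * x = b * y" using assms(2) by blast
  have "b = 3 * (b div 3) + 1 \<or> b = 3 * (b div 3) + 2" using assms(1) by presburger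
  then obtain a where "b = 3 * a + 1 \<or> b = 3 * a + 2" by blast
  then have "y = 3 * (x - a * y) \<or> y = 3 * (y - x + a * y)" using y by (auto simp: algebra_simps)
  then obtain z where "y = 3 * z" by blast
  then have "x = b * z" using y by simp
  then show ?thesis by simp
qed

section \<open>Monochromatic paths and cycles\<close>

text \<open>With \<open>p\<close> instead of \<open>k\<close> as parameter,
  \<open>k = 2 * l + p\<close> and a block has \<open>l + p\<close> vertices, without subtraction.
  For \<open>l = k / 2\<close> all private sets are empty, which the arguments allow.\<close>

locale coloured_hypergraph =
  fixes l p :: nat and \<chi> :: "'a set \<Rightarrow> colour"
  assumes l_pos: "0 < l"
begin

text \<open>A path consists of disjoint sets \<open>S\<^sub>0, P\<^sub>0, S\<^sub>1, \<dots>, P\<^sub>m\<^sub>-\<^sub>2, S\<^sub>m\<^sub>-\<^sub>1\<close> with edges \<open>S\<^sub>i \<union> P\<^sub>i \<union> S\<^sub>i\<^sub>+\<^sub>1\<close>: the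
  joints \<open>S\<^sub>i\<close> are the intersections of consecutive edges, so \<open>p = k - 2 l\<close>. In \<open>path c m A B W\<close> the number
  \<open>m\<close> counts joints, \<open>A\<close> and \<open>B\<close> are the end joints and \<open>W\<close> is the set of all vertices.\<close>
inductive path :: "colour \<Rightarrow> nat \<Rightarrow> 'a set \<Rightarrow> 'a set \<Rightarrow> 'a set \<Rightarrow> bool" for c where
  single: "sized l A \<Longrightarrow> path c (Suc 0) A A A"
| step: "\<lbrakk>path c m A B W; sized p P; sized l S; P \<inter> W = {}; S \<inter> W = {}; P \<inter> S = {};
          \<chi> (B \<union> P \<union> S) = c\<rbrakk> \<Longrightarrow> path c (Suc m) A S (W \<union> P \<union> S)"

lemma path_basic:
  assumes "path c m A B W"
  shows "0 < m" "A \<subseteq> W" "B \<subseteq> W" "sized l A" "sized l B" "finite W"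
    "card W + p = m * (l + p)" "m = 1 \<Longrightarrow> A = B" "m = 1 \<Longrightarrow> W = A" "2 \<le> m \<Longrightarrow> A \<inter> B = {}"
proof -
  have "0 < m \<and> A \<subseteq> W \<and> B \<subseteq> W \<and> sized l A \<and> sized l B \<and> finite W \<and> card W + p = m * (l + p)
    \<and> (m = 1 \<longrightarrow> A = B \<and> W = A) \<and> (2 \<le> m \<longrightarrow> A \<inter> B = {})"
    using assms
  proof induction
    case (single A)
    then show ?case by (auto simp: sized_def)
  next
    case (step m A B W P S)
    then have "card (W \<union> P \<union> S) = card W + p + l"
      by (subst card_Un_disjoint; (subst card_Un_disjoint)?) (auto simp: sized_def)
    with step show ?case by (auto dest: sized_finite)
  qed
  then show "0 < m" "A \<subseteq> W" "B \<subseteq> W" "sized l A" "sized l B" "finite W"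
    "card W + p = m * (l + p)" "m = 1 \<Longrightarrow> A = B" "m = 1 \<Longrightarrow> W = A" "2 \<le> m \<Longrightarrow> A \<inter> B = {}"
    by auto
qed

lemma path_join:
  assumes "path c m A B W" "path c m' A' B' W'" "sized p P"
    "W \<inter> W' = {}" "P \<inter> W = {}" "P \<inter> W' = {}" "\<chi> (B \<union> P \<union> A') = c"
  shows "path c (m + m') A B' (W \<union> P \<union> W')"
  using assms(2,4,6,7)
proof (induction)
  case (single A')
  then show ?case using path.step[OF assms(1,3)] assms by (auto simp: Int_commute)
next
  case (step n A' B' W' P' S)
  have "path c (Suc (m + n)) A S ((W \<union> P \<union> W') \<union> P' \<union> S)"
    by (rule path.step[OF step.IH]) (use step in auto)
  then show ?case by (simp add: Un_assoc)
qed

lemma path_rev: "path c m A B W \<Longrightarrow> path c m B A W"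
proof (induction rule: path.induct)
  case (single A)
  then show ?case by (rule path.single)
next
  case (step m A B W P S)
  have "path c (1 + m) S A (S \<union> P \<union> W)"
    using step by (intro path_join) (auto intro: path.single simp: Un_ac Int_commute)
  then show ?case by (simp add: Un_ac)
qed

lemma path_split_last:
  assumes "path c m A B W" "2 \<le> m"
  obtains B' P W' where "path c (m - 1) A B' W'" "sized p P" "P \<inter> W' = {}" "B \<inter> W' = {}"
    "P \<inter> B = {}" "\<chi> (B' \<union> P \<union> B) = c" "W = W' \<union> P \<union> B"
  using assms by (cases rule: path.cases) auto

lemma path_drop_last:
  assumes "path c m A B W" "2 \<le> m"
  obtains B' W' where "path c (m - 1) A B' W'" "W' \<subseteq> W" "B \<inter> W' = {}"
proof -
  obtain B' P W' where "path c (m - 1) A B' W'" "B \<inter> W' = {}" "W = W' \<union> P \<union> B"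
    by (rule path_split_last[OF assms])
  then show thesis using that by blast
qed

lemma path_drop_first:
  assumes "path c m A B W" "2 \<le> m"
  obtains A' W' where "path c (m - 1) A' B W'" "W' \<subseteq> W" "A \<inter> W' = {}"
proof -
  obtain A' W' where "path c (m - 1) B A' W'" "W' \<subseteq> W" "A \<inter> W' = {}"
    by (rule path_drop_last[OF path_rev[OF assms(1)] assms(2)])
  then show thesis using that path_rev by blast
qed

lemma path_drop_both:
  assumes "path c m A B W" "3 \<le> m"
  obtains A' B' W' where "path c (m - 2) A' B' W'" "W' \<subseteq> W" "A \<inter> W' = {}" "B \<inter> W' = {}"
proof -
  have "2 \<le> m" "2 \<le> m - 1" using assms(2) by auto
  obtain B' W1 where 1: "path c (m - 1) A B' W1" "W1 \<subseteq> W" "B \<inter> W1 = {}"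
    by (rule path_drop_last[OF assms(1) \<open>2 \<le> m\<close>])
  obtain A' W' where 2: "path c (m - 1 - 1) A' B' W'" "W' \<subseteq> W1" "A \<inter> W' = {}"
    by (rule path_drop_first[OF 1(1) \<open>2 \<le> m - 1\<close>])
  have "m - 1 - 1 = m - 2" by simp
  with 1 2 that[of A' B' W'] show thesis by auto
qed

lemma path_of_sequence:
  assumes "\<And>i. i \<le> n \<Longrightarrow> sized l (X i)" "\<And>i. i < n \<Longrightarrow> sized p (Y i)"
    "\<And>i j. \<lbrakk>i \<le> n; j \<le> n; i \<noteq> j\<rbrakk> \<Longrightarrow> X i \<inter> X j = {}"
    "\<And>i j. \<lbrakk>i < n; j < n; i \<noteq> j\<rbrakk> \<Longrightarrow> Y i \<inter> Y j = {}"
    "\<And>i j. \<lbrakk>i \<le> n; j < n\<rbrakk> \<Longrightarrow> X i \<inter> Y j = {}"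
    "\<And>i. i < n \<Longrightarrow> \<chi> (X i \<union> Y i \<union> X (Suc i)) = c"
  shows "path c (Suc n) (X 0) (X n) ((\<Union>i\<le>n. X i) \<union> (\<Union>i<n. Y i))"
  using assms
proof (induction n)
  case 0
  then show ?case using path.single by simp
next
  case (Suc n)
  have "path c (Suc (Suc n)) (X 0) (X (Suc n)) (((\<Union>i\<le>n. X i) \<union> (\<Union>i<n. Y i)) \<union> Y n \<union> X (Suc n))"
  proof (rule path.step)
    show "path c (Suc n) (X 0) (X n) ((\<Union>i\<le>n. X i) \<union> (\<Union>i<n. Y i))"
      by (rule Suc.IH) (use Suc.prems in auto)
    show "Y n \<inter> ((\<Union>i\<le>n. X i) \<union> (\<Union>i<n. Y i)) = {}"
    proof -
      have "Y n \<inter> Y i = {}" if "i < n" for i using Suc.prems(4)[of n i] that by simp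
      moreover have "X i \<inter> Y n = {}" if "i \<le> n" for i using Suc.prems(5)[of i n] that by simp
      ultimately show ?thesis by blast
    qed
    show "X (Suc n) \<inter> ((\<Union>i\<le>n. X i) \<union> (\<Union>i<n. Y i)) = {}"
    proof -
      have "X (Suc n) \<inter> X i = {}" if "i \<le> n" for i using Suc.prems(3)[of "Suc n" i] that by simp
      moreover have "X (Suc n) \<inter> Y i = {}" if "i < n" for i using Suc.prems(5)[of "Suc n" i] that by simp
      ultimately show ?thesis by blast
    qed
    show "Y n \<inter> X (Suc n) = {}" using Suc.prems(5)[of "Suc n" n] by auto
  qed (use Suc.prems in auto)
  then show ?case by (simp add: atMost_Suc lessThan_Suc Un_ac)
qed

text \<open>An indexed form of \<open>path\<close> from which cyclic indexings are built. The value
  \<open>Y (m - 1)\<close> is left unconstrained; it later receives the private set that closes the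
  cycle.\<close>

definition path_blocks :: "colour \<Rightarrow> nat \<Rightarrow> (nat \<Rightarrow> 'a set) \<Rightarrow> (nat \<Rightarrow> 'a set) \<Rightarrow> bool" where
  "path_blocks c m X Y \<longleftrightarrow> (\<forall>i<m. sized l (X i)) \<and>
     (\<forall>i. Suc i < m \<longrightarrow> sized p (Y i) \<and> \<chi> (X i \<union> Y i \<union> X (Suc i)) = c) \<and>
     (\<forall>i<m. \<forall>j<m. i \<noteq> j \<longrightarrow> X i \<inter> X j = {}) \<and>
     (\<forall>i j. Suc i < m \<longrightarrow> Suc j < m \<longrightarrow> i \<noteq> j \<longrightarrow> Y i \<inter> Y j = {}) \<and>
     (\<forall>i j. i < m \<longrightarrow> Suc j < m \<longrightarrow> X i \<inter> Y j = {})"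

lemma path_imp_blocks:
  assumes "path c m A B W"
  obtains X Y where "path_blocks c m X Y" "X 0 = A" "X (m - 1) = B"
    "W = (\<Union>i<m. X i) \<union> (\<Union>i<m - 1. Y i)"
  using assms
proof (induction arbitrary: thesis)
  case (single A)
  show ?case by (rule single(2)[of "\<lambda>_. A" "\<lambda>_. {}"]) (use single(1) in \<open>auto simp: path_blocks_def\<close>)
next
  case (step m A B W P S)
  obtain X Y where XY: "path_blocks c m X Y"
    and "X 0 = A" "X (m - 1) = B" and W: "W = (\<Union>i<m. X i) \<union> (\<Union>i<m - 1. Y i)"
    by (rule step.IH)
  have s: "\<And>i. i < m \<Longrightarrow> sized l (X i)" "\<And>i. Suc i < m \<Longrightarrow> sized p (Y i)"
    and d: "\<And>i j. \<lbrakk>i < m; j < m; i \<noteq> j\<rbrakk> \<Longrightarrow> X i \<inter> X j = {}"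
    "\<And>i j. \<lbrakk>Suc i < m; Suc j < m; i \<noteq> j\<rbrakk> \<Longrightarrow> Y i \<inter> Y j = {}"
    "\<And>i j. \<lbrakk>i < m; Suc j < m\<rbrakk> \<Longrightarrow> X i \<inter> Y j = {}"
    and e: "\<And>i. Suc i < m \<Longrightarrow> \<chi> (X i \<union> Y i \<union> X (Suc i)) = c"
    using XY unfolding path_blocks_def by simp_all
  have m: "0 < m" by (rule path_basic(1)[OF step.hyps(1)])
  have XW: "X i \<inter> S = {} \<and> X i \<inter> P = {}" if "i < m" for i
    using that step.hyps W by auto
  have YW: "Y i \<inter> S = {} \<and> Y i \<inter> P = {}" if "Suc i < m" for i
  proof -
    have "Y i \<subseteq> W" using that W by auto
    then show ?thesis using step.hyps by auto
  qed
  have eq: "m - Suc 0 = i" if "i < m" "\<not> Suc i < m" for i using that by auto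
  let ?X = "X(m := S)" and ?Y = "Y(m - 1 := P)"
  show ?case
  proof (rule step.prems[of ?X ?Y])
    have l: "i = m - 1 \<or> Suc i < m" if "Suc i < Suc m" for i using that by auto
    have XX: "?X i \<inter> ?X j = {}" if "i < Suc m" "j < Suc m" "i \<noteq> j" for i j
      using that d(1)[of i j] XW[of i] XW[of j] by (auto simp: less_Suc_eq)
    have YY: "?Y i \<inter> ?Y j = {}" if "Suc i < Suc m" "Suc j < Suc m" "i \<noteq> j" for i j
      using that l[of i] l[of j] d(2)[of i j] YW[of i] YW[of j] by auto
    have XY: "?X i \<inter> ?Y j = {}" if "i < Suc m" "Suc j < Suc m" for i j
      using that l[of j] d(3)[of i j] YW[of j] XW[of i] step.hyps by auto
    have E: "\<chi> (?X i \<union> ?Y i \<union> ?X (Suc i)) = c" if "Suc i < Suc m" for i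
    proof (cases "Suc i < m")
      case True
      then show ?thesis using e[of i] by auto
    next
      case False
      then have "m = Suc i" using that by auto
      then show ?thesis using step.hyps \<open>X (m - 1) = B\<close> by auto
    qed
    have S: "sized p (?Y i)" if "Suc i < Suc m" for i using that l[of i] s step.hyps by auto
    show "path_blocks c (Suc m) ?X ?Y"
      unfolding path_blocks_def using XX YY XY E S s step.hyps by (simp add: less_Suc_eq)
    show "W \<union> P \<union> S = (\<Union>i<Suc m. ?X i) \<union> (\<Union>i<Suc m - 1. ?Y i)"
    proof -
      have "(\<Union>i<Suc m. ?X i) = (\<Union>i<m. X i) \<union> S" by (auto simp: lessThan_Suc)
      moreover have "(\<Union>i<m. ?Y i) = (\<Union>i<m - 1. Y i) \<union> P"
      proof -
        have "{..<m} = insert (m - 1) {..<m - 1}" using m by auto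
        then show ?thesis by auto
      qed
      ultimately show ?thesis using W by auto
    qed
  qed (use m \<open>X 0 = A\<close> in auto)
qed

text \<open>A cycle is a path through all its joints plus one private set joining the ends. For
  \<open>m = 2\<close> and \<open>p = 0\<close> the closing edge equals the only edge of the path,
  which is the single edge counted twice.\<close>

definition closed :: "colour \<Rightarrow> nat \<Rightarrow> 'a set \<Rightarrow> bool" where
  "closed c m W \<longleftrightarrow> (\<exists>A B Y W'. 2 \<le> m \<and> path c m A B W' \<and> sized p Y \<and> Y \<inter> W' = {} \<and>
     \<chi> (A \<union> Y \<union> B) = c \<and> W = W' \<union> Y)"

lemma closedI:
  "\<lbrakk>path c m A B W; 2 \<le> m; sized p Y; Y \<inter> W = {}; \<chi> (A \<union> Y \<union> B) = c\<rbrakk> \<Longrightarrow> closed c m (W \<union> Y)"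
  unfolding closed_def by blast

lemma closed_card: "closed c m W \<Longrightarrow> finite W \<and> card W = m * (l + p) \<and> 2 \<le> m"
proof -
  assume "closed c m W"
  then obtain A B Y W' where *: "2 \<le> m" "path c m A B W'" "sized p Y" "Y \<inter> W' = {}" "W = W' \<union> Y"
    unfolding closed_def by blast
  have "card W = card W' + p" using * path_basic(6)[OF *(2)]
    by (subst *(5), subst card_Un_disjoint) (auto simp: sized_def)
  then show ?thesis using * path_basic(6,7)[OF *(2)] by (auto dest: sized_finite)
qed

definition cyclic_blocks :: "colour \<Rightarrow> nat \<Rightarrow> (nat \<Rightarrow> 'a set) \<Rightarrow> (nat \<Rightarrow> 'a set) \<Rightarrow> bool" where
  "cyclic_blocks c m X P \<longleftrightarrow> 2 \<le> m \<and>
     (\<forall>i<m. sized l (X i) \<and> sized p (P i) \<and> \<chi> (X i \<union> P i \<union> X (Suc i mod m)) = c) \<and>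
     (\<forall>i<m. \<forall>j<m. i \<noteq> j \<longrightarrow> X i \<inter> X j = {} \<and> P i \<inter> P j = {}) \<and>
     (\<forall>i<m. \<forall>j<m. X i \<inter> P j = {})"

lemma closed_blocks:
  assumes "closed c m W"
  obtains X P where "cyclic_blocks c m X P" "W = (\<Union>i<m. X i \<union> P i)"
proof -
  obtain A B Q W' where 2: "2 \<le> m" and pth: "path c m A B W'" and Q: "sized p Q" "Q \<inter> W' = {}"
    "\<chi> (A \<union> Q \<union> B) = c" and W: "W = W' \<union> Q"
    using assms unfolding closed_def by blast
  obtain X Y where XY: "path_blocks c m X Y"
    and A: "X 0 = A" and B: "X (m - 1) = B" and W': "W' = (\<Union>i<m. X i) \<union> (\<Union>i<m - 1. Y i)"
    by (rule path_imp_blocks[OF pth])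
  have s: "\<And>i. i < m \<Longrightarrow> sized l (X i)" "\<And>i. Suc i < m \<Longrightarrow> sized p (Y i)"
    and d: "\<And>i j. \<lbrakk>i < m; j < m; i \<noteq> j\<rbrakk> \<Longrightarrow> X i \<inter> X j = {}"
    "\<And>i j. \<lbrakk>Suc i < m; Suc j < m; i \<noteq> j\<rbrakk> \<Longrightarrow> Y i \<inter> Y j = {}"
    "\<And>i j. \<lbrakk>i < m; Suc j < m\<rbrakk> \<Longrightarrow> X i \<inter> Y j = {}"
    and e: "\<And>i. Suc i < m \<Longrightarrow> \<chi> (X i \<union> Y i \<union> X (Suc i)) = c"
    using XY unfolding path_blocks_def by simp_all
  let ?P = "Y(m - 1 := Q)"
  have XQ: "X i \<inter> Q = {}" if "i < m" for i using that Q(2) W' by auto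
  have YQ: "Y i \<inter> Q = {}" if "Suc i < m" for i
  proof -
    have "Y i \<subseteq> W'" using that W' by auto
    then show ?thesis using Q by auto
  qed
  have ms: "{..<m} = insert (m - 1) {..<m - 1}" using 2 by auto
  show thesis
  proof
    show "W = (\<Union>i<m. X i \<union> ?P i)"
    proof -
      have "(\<Union>i<m. ?P i) = (\<Union>i<m - 1. Y i) \<union> Q" by (subst ms) auto
      then show ?thesis unfolding UN_Un_distrib by (simp add: W W' Un_assoc)
    qed
    have last: "i = m - 1 \<or> Suc i < m" if "i < m" for i using that by auto
    show "cyclic_blocks c m X ?P"
      unfolding cyclic_blocks_def
    proof (intro conjI allI impI 2)
      fix i assume i: "i < m"
      show "sized l (X i)" using s i by simp
      show "sized p (?P i)" using s last[OF i] Q by auto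
      show "\<chi> (X i \<union> ?P i \<union> X (Suc i mod m)) = c"
      proof (cases "i = m - 1")
        case True
        then have "Suc i mod m = 0" using 2 by simp
        then show ?thesis using True A B Q(3) by (simp add: Un_ac)
      next
        case False
        then show ?thesis using e[of i] last[OF i] by simp
      qed
    next
      fix i j assume i: "i < m" and j: "j < m"
      show "X i \<inter> ?P j = {}" using d(3)[of i j] XQ[of i] i last[OF j] by auto
      assume n: "i \<noteq> j"
      show "X i \<inter> X j = {}" using d(1) i j n by simp
      show "?P i \<inter> ?P j = {}" using d(2)[of i j] YQ[of i] YQ[of j] last[OF i] last[OF j] n by auto
    qed
  qed
qed

section \<open>Translation into the cycles of the statement\<close>

lemma two_cycle_blocks:
  assumes "cyclic_blocks c 2 X P"
  shows "two_cycle (2 * l + p) l ((\<Union>i<2. X i \<union> P i),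
           (\<lambda>i. X i \<union> P i \<union> X (Suc i mod 2)) ` {..<2})"
proof -
  have 2: "{..<2} = {0, 1 :: nat}" by auto
  have s: "sized l (X 0)" "sized l (X 1)" "sized p (P 0)" "sized p (P 1)"
    and d: "X 0 \<inter> X 1 = {}" "P 0 \<inter> P 1 = {}" "X 0 \<inter> P 0 = {}" "X 0 \<inter> P 1 = {}"
      "X 1 \<inter> P 0 = {}" "X 1 \<inter> P 1 = {}"
    using assms unfolding cyclic_blocks_def by auto
  let ?e = "X 0 \<union> P 0 \<union> X 1" and ?f = "X 1 \<union> P 1 \<union> X 0"
  have "sized (l + p + l) ?e" "sized (l + p + l) ?f"
    by (intro sized_Un s; use d in auto)+
  moreover have "?e \<inter> ?f = X 0 \<union> X 1" using d by auto
  moreover have "sized (l + l) (X 0 \<union> X 1)" by (intro sized_Un s d)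
  moreover have "(\<Union>i<2. X i \<union> P i) = ?e \<union> ?f" by (subst 2) auto
  moreover have "(\<lambda>i. X i \<union> P i \<union> X (Suc i mod 2)) ` {..<2} = {?e, ?f}" by (subst 2) simp
  ultimately show ?thesis
    unfolding two_cycle_def
    by (intro exI[of _ ?e] exI[of _ ?f]) (simp add: sized_def mult_2 ac_simps)
qed

text \<open>Block \<open>i\<close> is numbered from \<open>i * d\<close> on, first the joint and
  then the private set. The \<open>d + l\<close> positions starting at \<open>i * d\<close> are then
  exactly \<open>X i\<close>, \<open>P i\<close> and the next joint.\<close>

lemma long_cycle_blocks:
  assumes "cyclic_blocks c m X P" "3 \<le> m"
  shows "long_cycle (2 * l + p) l m ((\<Union>i<m. X i \<union> P i),
           (\<lambda>i. X i \<union> P i \<union> X (Suc i mod m)) ` {..<m})"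
proof -
  define d where "d = l + p"
  have d0: "0 < d" "l \<le> d" using l_pos by (auto simp: d_def)
  have s: "sized l (X i)" "sized p (P i)" if "i < m" for i
    using assms that unfolding cyclic_blocks_def by auto
  have dis: "X i \<inter> X j = {}" "P i \<inter> P j = {}" if "i < m" "j < m" "i \<noteq> j" for i j
    using assms that unfolding cyclic_blocks_def by auto
  have XP: "X i \<inter> P j = {}" if "i < m" "j < m" for i j
    using assms that unfolding cyclic_blocks_def by auto
  have "\<forall>i. \<exists>f. i < m \<longrightarrow> bij_betw f {0..<l} (X i)"
    using s(1) ex_bij_betw_nat_finite unfolding sized_def by metis
  then obtain f where f: "\<And>i. i < m \<Longrightarrow> bij_betw (f i) {0..<l} (X i)" by metis
  have "\<forall>i. \<exists>g. i < m \<longrightarrow> bij_betw g {0..<p} (P i)"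
    using s(2) ex_bij_betw_nat_finite unfolding sized_def by metis
  then obtain g where g: "\<And>i. i < m \<Longrightarrow> bij_betw (g i) {0..<p} (P i)" by metis
  define u where "u i j = (if j < l then f i j else g i (j - l))" for i j
  have uX: "u i ` {..<l} = X i" if "i < m" for i
  proof -
    have "u i ` {..<l} = f i ` {0..<l}" by (intro image_cong) (auto simp: u_def)
    then show ?thesis using f[OF that] unfolding bij_betw_def by simp
  qed
  have uP: "u i ` {l..<d} = P i" if "i < m" for i
  proof -
    have "u i ` {l..<d} = (\<lambda>j. g i (j - l)) ` {l..<d}" by (auto simp: u_def)
    also have "\<dots> = g i ` ((\<lambda>j. j - l) ` {l..<d})" by (simp add: image_image)
    also have "(\<lambda>j. j - l) ` {l..<d} = {0..<p}"
    proof -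
      have "j \<in> (\<lambda>j. j - l) ` {l..<d}" if "j < p" for j
        using that by (intro image_eqI[of _ _ "j + l"]) (auto simp: d_def)
      then show ?thesis by (auto simp: d_def)
    qed
    finally show ?thesis using g[OF that] unfolding bij_betw_def by simp
  qed
  have u_in: "u i j \<in> (if j < l then X i else P i)" if "i < m" "j < d" for i j
    using uX[OF that(1)] uP[OF that(1)] imageI[of j "{..<l}" "u i"] imageI[of j "{l..<d}" "u i"]
      that(2) by auto
  have u_inj: "i = i' \<and> j = j'" if "i < m" "j < d" "i' < m" "j' < d" "u i j = u i' j'" for i j i' j'
  proof -
    have "(j < l) = (j' < l)"
      using u_in[OF that(1,2)] u_in[OF that(3,4)] that(5) XP[OF that(1,3)] XP[OF that(3,1)]
      by (auto split: if_splits)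
    moreover have "i = i'"
      using u_in[OF that(1,2)] u_in[OF that(3,4)] that(5) dis[OF that(1,3)] calculation
      by (auto split: if_splits)
    moreover have "j = j'"
    proof (cases "j < l")
      case True
      then show ?thesis using calculation that(5) f[OF that(1)]
        unfolding u_def bij_betw_def inj_on_def by auto
    next
      case False
      then have "j - l < p" "j' - l < p" "g i (j - l) = g i (j' - l)"
        using that calculation by (auto simp: d_def u_def)
      then have "j - l = j' - l" using g[OF that(1)] unfolding bij_betw_def inj_on_def by auto
      then show ?thesis using False calculation by auto
    qed
    ultimately show ?thesis by simp
  qed
  define v where "v x = u (x div d) (x mod d)" for x
  have dm: "x div d < m" "x mod d < d" if "x < m * d" for x
    using that d0 by (auto simp: less_mult_imp_div_less)
  have vm: "v ((a * d + j) mod (m * d)) = u (a mod m) j" if "j < d" for a j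
  proof -
    have "(a * d + j) mod (m * d) = d * (a mod m) + j"
      using that mod_mult2_eq[of "a * d + j" d m] by (simp add: mult.commute)
    then show ?thesis using that by (simp add: v_def)
  qed
  have inj: "inj_on v {..<m * d}"
  proof (rule inj_onI)
    fix x y assume xy: "x \<in> {..<m * d}" "y \<in> {..<m * d}" "v x = v y"
    then have "x div d = y div d \<and> x mod d = y mod d"
      using u_inj[of "x div d" "x mod d" "y div d" "y mod d"] dm unfolding v_def by auto
    then show "x = y" by (metis div_mult_mod_eq)
  qed
  have img: "v ` {..<m * d} = (\<Union>i<m. X i \<union> P i)"
  proof (intro equalityI subsetI)
    fix y assume "y \<in> v ` {..<m * d}"
    then obtain x where x: "x < m * d" "y = v x" by auto
    then show "y \<in> (\<Union>i<m. X i \<union> P i)"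
      using u_in[OF dm[OF x(1)]] dm[OF x(1)] unfolding v_def by (auto split: if_splits)
  next
    fix y assume "y \<in> (\<Union>i<m. X i \<union> P i)"
    then obtain i where i: "i < m" "y \<in> X i \<union> P i" by auto
    then have "y \<in> u i ` ({..<l} \<union> {l..<d})"
      using uX[OF i(1)] uP[OF i(1)] by (simp add: image_Un)
    moreover have "{..<l} \<union> {l..<d} = {..<d}" using d0(2) by auto
    ultimately obtain j where j: "j < d" "y = u i j" by auto
    have "y = v ((i * d + j) mod (m * d))" using vm[OF j(1), of i] j i by simp
    moreover have "(i * d + j) mod (m * d) < m * d" using d0 i by simp
    ultimately show "y \<in> v ` {..<m * d}" by blast
  qed
  have edge: "(\<lambda>j. v ((i * d + j) mod (m * d))) ` {..<2 * l + p} = X i \<union> P i \<union> X (Suc i mod m)"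
    if "i < m" for i
  proof -
    have "{..<2 * l + p} = {..<l} \<union> {l..<d} \<union> (\<lambda>j. d + j) ` {..<l}"
    proof (intro equalityI subsetI)
      fix x assume "x \<in> {..<2 * l + p}"
      then have "x < d \<or> x = d + (x - d) \<and> x - d < l" by (auto simp: d_def)
      then show "x \<in> {..<l} \<union> {l..<d} \<union> (\<lambda>j. d + j) ` {..<l}" by (auto simp: image_iff)
    qed (auto simp: d_def)
    then have "(\<lambda>j. v ((i * d + j) mod (m * d))) ` {..<2 * l + p} =
      (\<lambda>j. v ((i * d + j) mod (m * d))) ` {..<l} \<union> (\<lambda>j. v ((i * d + j) mod (m * d))) ` {l..<d}
      \<union> (\<lambda>j. v ((Suc i * d + j) mod (m * d))) ` {..<l}"
      by (simp add: image_Un image_image algebra_simps)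
    also have "(\<lambda>j. v ((i * d + j) mod (m * d))) ` {..<l} = u i ` {..<l}"
      using vm[of _ i] d0(2) that by (intro image_cong) auto
    also have "(\<lambda>j. v ((i * d + j) mod (m * d))) ` {l..<d} = u i ` {l..<d}"
      using vm[of _ i] that by (intro image_cong) auto
    also have "(\<lambda>j. v ((Suc i * d + j) mod (m * d))) ` {..<l} = u (Suc i mod m) ` {..<l}"
      using vm[of _ "Suc i"] d0(2) by (intro image_cong) auto
    finally show ?thesis using uX[OF that] uP[OF that] uX[of "Suc i mod m"] that by simp
  qed
  have kl: "2 * l + p - l = d" by (simp add: d_def)
  show ?thesis
    unfolding long_cycle_def kl
    using assms(2) inj img edge by (intro conjI exI[of _ v]) auto
qed

lemma closed_l_cycle:
  assumes "closed c m W"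
  obtains E where "l_cycle (2 * l + p) l (W, E)"
    "\<And>e. e \<in> E \<Longrightarrow> e \<subseteq> W \<and> finite e \<and> card e = 2 * l + p \<and> \<chi> e = c"
proof -
  obtain X P where X: "cyclic_blocks c m X P" and W: "W = (\<Union>i<m. X i \<union> P i)"
    by (rule closed_blocks[OF assms])
  have m: "2 \<le> m" using X by (simp add: cyclic_blocks_def)
  let ?E = "(\<lambda>i. X i \<union> P i \<union> X (Suc i mod m)) ` {..<m}"
  show thesis
  proof
    show "l_cycle (2 * l + p) l (W, ?E)"
    proof (cases "m = 2")
      case True
      then show ?thesis using two_cycle_blocks X W unfolding l_cycle_def by simp
    next
      case False
      then have "3 \<le> m" using m by simp
      then show ?thesis using long_cycle_blocks[OF X] W unfolding l_cycle_def by blast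
    qed
    fix e assume "e \<in> ?E"
    then obtain i where i: "i < m" "e = X i \<union> P i \<union> X (Suc i mod m)" by auto
    have j: "Suc i mod m < m" using m by simp
    have ij: "i \<noteq> Suc i mod m" using i m
      by (metis Suc_lessI mod_Suc mod_less n_not_Suc_n not_numeral_le_zero Suc_n_not_le_n numeral_2_eq_2)
    have d: "X i \<inter> P i = {}" "X i \<inter> X (Suc i mod m) = {}" "X (Suc i mod m) \<inter> P i = {}"
      and s: "sized l (X i)" "sized p (P i)" "sized l (X (Suc i mod m))"
      using X i(1) j ij unfolding cyclic_blocks_def by simp_all
    have "sized (l + p + l) e"
      unfolding i(2) by (intro sized_Un s) (use d in auto)
    moreover have "e \<subseteq> W" using i j W by auto
    moreover have "\<chi> e = c" using X i by (simp add: cyclic_blocks_def)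
    ultimately show "e \<subseteq> W \<and> finite e \<and> card e = 2 * l + p \<and> \<chi> e = c"
      by (simp add: sized_def)
  qed
qed

text \<open>Counting blocks treats an absent cycle (0) and a degenerate one (1) like proper cycles.
  These two cases do not mention \<open>c\<close>, so they are available in either colour.\<close>

definition cover_cycle :: "colour \<Rightarrow> nat \<Rightarrow> 'a set \<Rightarrow> bool" where
  "cover_cycle c m W \<longleftrightarrow> m = 0 \<and> W = {} \<or> m = 1 \<and> sized (l + p) W \<or> closed c m W"

lemma cover_cycle_card: "cover_cycle c m W \<Longrightarrow> finite W \<and> card W = m * (l + p)"
  using closed_card unfolding cover_cycle_def sized_def by auto

lemma cover_cycle_l_cycle:
  assumes "cover_cycle c m W" "W \<subseteq> V"
  obtains \<C> where "finite \<C>" "card \<C> \<le> 1" "(\<Union>C\<in>\<C>. verts C) = W"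
    "\<And>C. C \<in> \<C> \<Longrightarrow> verts C = W \<and> W \<noteq> {} \<and> l_cycle (2 * l + p) l C \<and>
       subhypergraph C (complete_hypergraph (2 * l + p) V) \<and> monochromatic_in \<chi> c C"
proof (cases "m = 0")
  case True
  then have "W = {}" using cover_cycle_card[OF assms(1)] by (metis card_0_eq mult_0)
  then show thesis using that[of "{}"] by simp
next
  case False
  have ne: "W \<noteq> {}" using False cover_cycle_card[OF assms(1)] l_pos by auto
  consider "m = 1" "sized (l + p) W" | "closed c m W"
    using assms False unfolding cover_cycle_def by blast
  then obtain E where "l_cycle (2 * l + p) l (W, E)"
    "\<And>e. e \<in> E \<Longrightarrow> e \<subseteq> W \<and> finite e \<and> card e = 2 * l + p \<and> \<chi> e = c"
  proof cases
    case 1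
    show thesis
      by (rule that[of "{}"])
        (use 1 in \<open>auto simp: l_cycle_def degenerate_cycle_def sized_def\<close>)
  next
    case 2
    show thesis using closed_l_cycle[OF 2] that by blast
  qed
  moreover from this have "subhypergraph (W, E) (complete_hypergraph (2 * l + p) V)"
    using assms(2) unfolding subhypergraph_def complete_hypergraph_def nsets_def by fastforce
  ultimately show thesis using ne
    by (intro that[of "{(W, E)}"]) (auto simp: monochromatic_in_def)
qed

lemma covered_by_two_cyclesI:
  assumes V: "finite V" "card V = N * (l + p)"
    and W: "cover_cycle c m W" "W \<subseteq> V" and W': "cover_cycle (opp c) m' W'" "W' \<subseteq> V"
    and "W \<inter> W' = {}" "N \<le> m + m' + t"
  shows "covered_by_two_cycles (2 * l + p) l V \<chi> (t * (l + p))"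
proof -
  obtain \<C> where C: "finite \<C>" "card \<C> \<le> 1" "(\<Union>C\<in>\<C>. verts C) = W"
    "\<And>C. C \<in> \<C> \<Longrightarrow> verts C = W \<and> W \<noteq> {} \<and> l_cycle (2 * l + p) l C \<and>
       subhypergraph C (complete_hypergraph (2 * l + p) V) \<and> monochromatic_in \<chi> c C"
    using cover_cycle_l_cycle[OF W] by blast
  obtain \<D> where D: "finite \<D>" "card \<D> \<le> 1" "(\<Union>C\<in>\<D>. verts C) = W'"
    "\<And>C. C \<in> \<D> \<Longrightarrow> verts C = W' \<and> W' \<noteq> {} \<and> l_cycle (2 * l + p) l C \<and>
       subhypergraph C (complete_hypergraph (2 * l + p) V) \<and> monochromatic_in \<chi> (opp c) C"
    using cover_cycle_l_cycle[OF W'] by blast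
  have eq: "C = C'" if "C \<in> \<E>" "C' \<in> \<E>" "finite \<E>" "card \<E> \<le> 1" for C C' and \<E> :: "'a hypergraph set"
    using that by (metis card_le_Suc0_iff_eq One_nat_def)
  \<comment> \<open>The vertex sets are nonempty and disjoint, so comparing with \<open>W\<close>
    tells the cycles apart; this also assigns colours to degenerate cycles, which have no edge to
    read a colour from.\<close>
  define col where "col C = (if verts C = W then c else opp c)" for C :: "'a hypergraph"
  have colC: "col C = c" if "C \<in> \<C>" for C using C(4)[OF that] by (simp add: col_def)
  have colD: "col C = opp c" if "C \<in> \<D>" for C
    using D(4)[OF that] \<open>W \<inter> W' = {}\<close> by (auto simp: col_def)
  have "card (\<C> \<union> \<D>) \<le> 2" using C(2) D(2) card_Un_le[of \<C> \<D>] by linarith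
  moreover have "\<forall>C\<in>\<C> \<union> \<D>. l_cycle (2 * l + p) l C \<and>
      subhypergraph C (complete_hypergraph (2 * l + p) V) \<and> monochromatic_in \<chi> (col C) C"
    using C(4) D(4) colC colD by auto
  moreover have "disjoint_family_on verts (\<C> \<union> \<D>)"
    unfolding disjoint_family_on_def
    using C D eq[of _ \<C>] eq[of _ \<D>] \<open>W \<inter> W' = {}\<close> by (metis Int_commute Un_iff)
  moreover have "inj_on col (\<C> \<union> \<D>)"
    using C(1,2) D(1,2) eq[of _ \<C>] eq[of _ \<D>] colC colD
    by (intro inj_onI) (metis Un_iff opp_neq(1))
  moreover have "card (V - (\<Union>C\<in>\<C> \<union> \<D>. verts C)) \<le> t * (l + p)"
  proof -
    have "card (W \<union> W') = (m + m') * (l + p)"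
      using cover_cycle_card[OF W(1)] cover_cycle_card[OF W'(1)] \<open>W \<inter> W' = {}\<close>
      by (subst card_Un_disjoint) (auto simp: algebra_simps)
    moreover have "card (V - (W \<union> W')) = card V - card (W \<union> W')"
      using V W W' by (intro card_Diff_subset) (auto intro: finite_subset)
    moreover have "N * (l + p) \<le> (m + m' + t) * (l + p)" using assms(8) by (rule mult_le_mono1)
    ultimately have "card (V - (W \<union> W')) \<le> t * (l + p)"
      using V(2) by (simp add: algebra_simps)
    then show ?thesis using C(3) D(3) by simp
  qed
  ultimately show ?thesis
    unfolding covered_by_two_cycles_def using C(1) D(1)
    by (intro exI[of _ "\<C> \<union> \<D>"] exI[of _ col]) simp
qed

end

section \<open>A cycle and a path missing one block\<close>

text \<open>The failure of the claim for a loss of \<open>t\<close> blocks, in a form in which any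
  two disjoint cycles that cover too much give a contradiction at once.\<close>

locale uncovered = coloured_hypergraph l p \<chi> for l p :: nat and \<chi> :: "'a set \<Rightarrow> colour" +
  fixes V :: "'a set" and N t :: nat
  assumes finite_V: "finite V" and card_V: "card V = N * (l + p)" and t_ge: "2 \<le> t"
    and uncovered: "\<lbrakk>cover_cycle c m W; cover_cycle (opp c) m' W'; W \<inter> W' = {}; W \<subseteq> V; W' \<subseteq> V\<rbrakk>
      \<Longrightarrow> m + m' + t < N"
begin

lemma uncovered_closed: "closed c m W \<Longrightarrow> W \<subseteq> V \<Longrightarrow> m + t < N"
  using uncovered[of c m W 0 "{}"] by (simp add: cover_cycle_def)

lemma uncovered_closed2:
  "\<lbrakk>closed c m W; closed (opp c) m' W'; W \<inter> W' = {}; W \<subseteq> V; W' \<subseteq> V\<rbrakk> \<Longrightarrow> m + m' + t < N"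
  using uncovered[of c m W m' W'] by (simp add: cover_cycle_def)

text \<open>The empty pair gives \<open>t < N\<close>, so there is room for two degenerate cycles,
  and these give \<open>2 + t < N\<close>.\<close>

lemma N_ge: "5 \<le> N"
proof -
  have "0 + 0 + t < N" by (rule uncovered[of Blue 0 "{}" 0 "{}"]) (auto simp: cover_cycle_def)
  then have "2 \<le> N" using t_ge by simp
  then have "(l + p) + (l + p) \<le> card V"
    unfolding card_V by (metis mult_2 mult_le_mono1)
  then obtain X Y where "X \<subseteq> V" "Y \<subseteq> V" "sized (l + p) X" "sized (l + p) Y" "X \<inter> Y = {}"
    by (rule obtain_sized2[OF finite_V])
  then have "1 + 1 + t < N"
    by (intro uncovered[of Blue 1 X 1 Y]) (auto simp: cover_cycle_def)
  then show ?thesis using t_ge by simp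
qed

section \<open>Pairs of disjoint paths in different colours\<close>

definition path_pair :: "colour \<Rightarrow> nat \<Rightarrow> nat \<Rightarrow> bool" where
  "path_pair c r u \<longleftrightarrow> (\<exists>A B W J K U. path c r A B W \<and> path (opp c) u J K U \<and>
     W \<inter> U = {} \<and> W \<subseteq> V \<and> U \<subseteq> V)"

definition state :: "colour \<Rightarrow> nat \<Rightarrow> nat \<Rightarrow> bool" where
  "state c b r \<longleftrightarrow> b + r + 1 = N \<and> (\<exists>C A B W. closed c b C \<and> path (opp c) r A B W \<and>
     C \<inter> W = {} \<and> C \<subseteq> V \<and> W \<subseteq> V)"

lemma path_pairI:
  "\<lbrakk>path c r A B W; path (opp c) u J K U; W \<inter> U = {}; W \<subseteq> V; U \<subseteq> V\<rbrakk> \<Longrightarrow> path_pair c r u"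
  unfolding path_pair_def by blast

lemma path_pair_opp: "path_pair c r u \<Longrightarrow> path_pair (opp c) u r"
  unfolding path_pair_def by (metis Int_commute opp_opp)

lemma stateI:
  "\<lbrakk>closed c b C; path (opp c) r A B W; C \<inter> W = {}; C \<subseteq> V; W \<subseteq> V; b + r + 1 = N\<rbrakk> \<Longrightarrow> state c b r"
  unfolding state_def by blast

text \<open>The path of colour \<open>c\<close> takes over the end \<open>J\<close> of the other
  path and continues to the free joint \<open>D\<close>: two joints gained, one lost. If
  \<open>J\<close> is the whole other path, it stops at \<open>J\<close>, and \<open>D\<close> alone
  becomes the other path.\<close>

lemma path_pair_grow:
  assumes W: "path c r A' A W" and U: "path (opp c) u J K U" and dis: "W \<inter> U = {}" "W \<subseteq> V" "U \<subseteq> V"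
    and X: "sized p X" "X \<inter> (W \<union> U) = {}" "X \<subseteq> V" and Y: "sized p Y" "Y \<inter> (W \<union> U) = {}" "Y \<subseteq> V"
    and D: "sized l D" "D \<inter> (W \<union> U) = {}" "D \<subseteq> V"
    and XYD: "X \<inter> Y = {}" "X \<inter> D = {}" "Y \<inter> D = {}"
    and col: "\<chi> (A \<union> X \<union> J) = c" "\<chi> (J \<union> Y \<union> D) = c"
  shows "\<exists>r' u'. path_pair c r' u' \<and> r' + u' = r + u + 1"
proof -
  note u = path_basic[OF U]
  have WJ: "path c (Suc r) A' J (W \<union> X \<union> J)"
    by (rule path.step[OF W]) (use u X dis col in auto)
  show ?thesis
  proof (cases "u = 1")
    case True
    have "path_pair c (Suc r) 1"
      by (rule path_pairI[OF WJ, of 1 D D D])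
        (use path.single[OF D(1)] u X D XYD dis in auto)
    then show ?thesis using True by (intro exI[of _ "Suc r"] exI[of _ 1]) simp
  next
    case False
    then have "2 \<le> u" using u(1) by simp
    then obtain J' U' where U': "path (opp c) (u - 1) J' K U'" "U' \<subseteq> U" "J \<inter> U' = {}"
      by (rule path_drop_first[OF U])
    have "path c (Suc (Suc r)) A' D (W \<union> X \<union> J \<union> Y \<union> D)"
      by (rule path.step[OF WJ]) (use u X Y D XYD dis col in auto)
    then have "path_pair c (Suc (Suc r)) (u - 1)"
      by (rule path_pairI[OF _ U'(1)]) (use U' u X Y D XYD dis in auto)
    then show ?thesis using \<open>2 \<le> u\<close> by (intro exI[of _ "Suc (Suc r)"] exI[of _ "u - 1"]) auto
  qed
qed

lemma card_free:
  assumes "path c r A B W" "path c' u J K U" "W \<inter> U = {}" "W \<subseteq> V" "U \<subseteq> V"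
  shows "card (V - (W \<union> U)) + (r + u) * (l + p) = N * (l + p) + 2 * p"
proof -
  note w = path_basic[OF assms(1)] and u = path_basic[OF assms(2)]
  have "card (W \<union> U) = card W + card U" using w u assms by (simp add: card_Un_disjoint)
  moreover have "card (V - (W \<union> U)) = card V - card (W \<union> U)"
    using assms w u by (intro card_Diff_subset) auto
  moreover have "card (W \<union> U) \<le> card V" using assms finite_V by (intro card_mono) auto
  moreover have "(r + u) * (l + p) = card W + card U + 2 * p"
    using w(7) u(7) by (simp add: add_mult_distrib)
  ultimately show ?thesis using card_V by simp
qed

text \<open>If \<open>D\<close> extends neither path, its edges to \<open>A\<close> and
  \<open>J\<close> have the wrong colours for these ends. Then the edge between \<open>A\<close> and
  \<open>J\<close>, whatever its colour, lets the path of that colour pass through the end of the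
  other one and go on to \<open>D\<close>.\<close>

lemma path_pair_Suc:
  assumes "path_pair c r u" "r + u < N"
  shows "\<exists>r' u'. path_pair c r' u' \<and> r' + u' = r + u + 1"
proof -
  obtain A' A W J K U where W: "path c r A' A W" and U: "path (opp c) u J K U"
    and dis: "W \<inter> U = {}" "W \<subseteq> V" "U \<subseteq> V"
    using assms(1) unfolding path_pair_def by blast
  note w = path_basic[OF W] and u = path_basic[OF U]
  have "(r + u + 1) * (l + p) \<le> N * (l + p)" using assms(2) by (intro mult_le_mono1) simp
  then have "p + p + l \<le> card (V - (W \<union> U))"
    using card_free[OF W U dis] by (simp add: algebra_simps)
  then obtain X Y D where XYD: "X \<subseteq> V - (W \<union> U)" "Y \<subseteq> V - (W \<union> U)" "D \<subseteq> V - (W \<union> U)"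
    "sized p X" "sized p Y" "sized l D" "X \<inter> Y = {}" "X \<inter> D = {}" "Y \<inter> D = {}"
    by (rule obtain_sized3[rotated]) (use finite_V in auto)
  consider "\<chi> (A \<union> X \<union> D) = c" | "\<chi> (J \<union> X \<union> D) = opp c"
    | "\<chi> (A \<union> Y \<union> D) = opp c" "\<chi> (J \<union> Y \<union> D) = c"
    | "\<chi> (A \<union> Y \<union> D) = c" | "\<chi> (J \<union> Y \<union> D) = opp c"
    by (metis not_colour_iff)
  then show ?thesis
  proof cases
    case 1
    have "path c (Suc r) A' D (W \<union> X \<union> D)"
      by (rule path.step[OF W]) (use XYD 1 in auto)
    then have "path_pair c (Suc r) u" by (rule path_pairI[OF _ U]) (use XYD dis in auto)
    then show ?thesis by (intro exI[of _ "Suc r"] exI[of _ u]) simp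
  next
    case 2
    have "path (opp c) (Suc u) K D (U \<union> X \<union> D)"
      by (rule path.step[OF path_rev[OF U]]) (use XYD 2 in auto)
    then have "path_pair c r (Suc u)" by (rule path_pairI[OF W]) (use XYD dis in auto)
    then show ?thesis by (intro exI[of _ r] exI[of _ "Suc u"]) simp
  next
    case 4
    have "path c (Suc r) A' D (W \<union> Y \<union> D)"
      by (rule path.step[OF W]) (use XYD 4 in auto)
    then have "path_pair c (Suc r) u" by (rule path_pairI[OF _ U]) (use XYD dis in auto)
    then show ?thesis by (intro exI[of _ "Suc r"] exI[of _ u]) simp
  next
    case 5
    have "path (opp c) (Suc u) K D (U \<union> Y \<union> D)"
      by (rule path.step[OF path_rev[OF U]]) (use XYD 5 in auto)
    then have "path_pair c r (Suc u)" by (rule path_pairI[OF W]) (use XYD dis in auto)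
    then show ?thesis by (intro exI[of _ r] exI[of _ "Suc u"]) simp
  next
    case 3
    show ?thesis
    proof (cases "\<chi> (A \<union> X \<union> J) = c")
      case True
      show ?thesis
        by (rule path_pair_grow[OF W U dis, of X Y D]) (use XYD 3 True in auto)
    next
      case False
      have "\<exists>r' u'. path_pair (opp c) r' u' \<and> r' + u' = u + r + 1"
        by (rule path_pair_grow[OF path_rev[OF U], of r A A' W X Y D])
          (use XYD 3 False dis path_rev[OF W] in \<open>auto simp: not_colour_iff Un_ac\<close>)
      then show ?thesis using path_pair_opp[of "opp c"] by (metis add.commute opp_opp)
    qed
  qed
qed

lemma path_pair_all: "\<exists>r u. path_pair c r u \<and> r + u = N"
proof -
  have "2 \<le> n \<Longrightarrow> n \<le> N \<Longrightarrow> \<exists>r u. path_pair c r u \<and> r + u = n" for n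
  proof (induction n rule: dec_induct)
    case base
    have "2 * (l + p) \<le> card V" unfolding card_V using N_ge by (intro mult_le_mono1) simp
    then have "l + l \<le> card V" by simp
    then obtain X Y where "X \<subseteq> V" "Y \<subseteq> V" "sized l X" "sized l Y" "X \<inter> Y = {}"
      by (rule obtain_sized2[OF finite_V])
    then have "path_pair c 1 1"
      using path.single by (intro path_pairI[of c 1 X X X 1 Y Y Y]) auto
    then show ?case by (metis one_add_one)
  next
    case (step n)
    then obtain r u where "path_pair c r u" "r + u = n" by auto
    then show ?case using path_pair_Suc[of c r u] step by auto
  qed
  then show ?thesis using N_ge by simp
qed

text \<open>Closing a path with \<open>N - 1\<close> joints would miss only one block, so edges
  joining its ends through outside vertices have the other colour. Two of them form a cycle of
  length two, and the path gives up both ends to it.\<close>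

lemma state_of_path:
  assumes W: "path c (N - 1) A B W" "W \<subseteq> V"
  shows "\<exists>c b r. state c b r"
proof -
  note w = path_basic[OF W(1)]
  have N: "2 \<le> N - 1" "3 \<le> N - 1" using N_ge by auto
  have "card (V - W) = card V - card W" using W w by (intro card_Diff_subset) auto
  moreover have "N * (l + p) = (N - 1) * (l + p) + (l + p)" using N_ge by (cases N) auto
  ultimately have "p + p \<le> card (V - W)" using w(7) card_V by simp
  then obtain X Y where XY: "X \<subseteq> V - W" "Y \<subseteq> V - W" "sized p X" "sized p Y" "X \<inter> Y = {}"
    by (rule obtain_sized2[rotated]) (use finite_V in auto)
  have opp: "\<chi> (A \<union> Z \<union> B) = opp c" if "Z \<subseteq> V - W" "sized p Z" for Z
  proof (rule ccontr)
    assume "\<chi> (A \<union> Z \<union> B) \<noteq> opp c"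
    then have "closed c (N - 1) (W \<union> Z)"
      using that N by (intro closedI[OF W(1)]) (auto simp: not_opp_iff)
    moreover have "W \<union> Z \<subseteq> V" using that W by auto
    ultimately have "N - 1 + t < N" by (rule uncovered_closed)
    then show False using t_ge by simp
  qed
  have "path (opp c) (Suc (Suc 0)) A B (A \<union> X \<union> B)"
    by (rule path.step[OF path.single]) (use w XY N opp in auto)
  then have "closed (opp c) (Suc (Suc 0)) (A \<union> X \<union> B \<union> Y)"
    using w XY N opp by (intro closedI) auto
  moreover obtain A' B' W' where "path c (N - 1 - 2) A' B' W'" "W' \<subseteq> W" "A \<inter> W' = {}" "B \<inter> W' = {}"
    by (rule path_drop_both[OF W(1) N(2)])
  ultimately have "state (opp c) (Suc (Suc 0)) (N - 1 - 2)"
    by (intro stateI[of "opp c" _ "A \<union> X \<union> B \<union> Y" _ A' B' W']) (use w XY W N_ge in auto)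
  then show ?thesis by blast
qed

text \<open>The path from \<open>J\<close> to \<open>K\<close> closes up through \<open>B\<close>
  and \<open>A\<close>, and the other path loses both its ends. If nothing is left of the latter
  (\<open>r = 2\<close>), the new cycle alone has \<open>N - 1\<close> blocks, which is
  excluded.\<close>

lemma state_of_crossing:
  assumes W: "path c r A B W" and U: "path (opp c) u J K U" and dis: "W \<inter> U = {}" "W \<subseteq> V" "U \<subseteq> V"
    and N: "r + u + 1 = N" "2 \<le> r"
    and XYZ: "sized p X" "sized p Y" "sized p Z" "X \<inter> Y = {}" "X \<inter> Z = {}" "Y \<inter> Z = {}"
      "X \<union> Y \<union> Z \<subseteq> V - (W \<union> U)"
    and col: "\<chi> (A \<union> X \<union> J) = opp c" "\<chi> (B \<union> Y \<union> K) = opp c" "\<chi> (A \<union> Z \<union> B) = opp c"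
  shows "\<exists>c b r. state c b r"
proof -
  note w = path_basic[OF W] and u = path_basic[OF U]
  have d: "A \<inter> B = {}" "A \<inter> U = {}" "B \<inter> U = {}" "A \<inter> X = {}" "A \<inter> Y = {}" "A \<inter> Z = {}"
    "B \<inter> X = {}" "B \<inter> Y = {}" "B \<inter> Z = {}" "X \<inter> U = {}" "Y \<inter> U = {}" "Z \<inter> U = {}"
    using w N XYZ dis by blast+
  have col': "\<chi> (K \<union> Y \<union> B) = opp c" "\<chi> (B \<union> Z \<union> A) = opp c" "\<chi> (J \<union> X \<union> A) = opp c"
    using col by (simp_all add: Un_ac)
  have "path (opp c) (Suc u) J B (U \<union> Y \<union> B)"
    by (rule path.step[OF U]) (use w(4,5) d XYZ(1-6) col' in auto)
  then have "path (opp c) (Suc (Suc u)) J A (U \<union> Y \<union> B \<union> Z \<union> A)"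
    by (rule path.step) (use w(4,5) d XYZ(1-6) col' in auto)
  then have cl: "closed (opp c) (Suc (Suc u)) (U \<union> Y \<union> B \<union> Z \<union> A \<union> X)"
    by (rule closedI) (use d XYZ(1-6) col' in auto)
  have sub: "U \<union> Y \<union> B \<union> Z \<union> A \<union> X \<subseteq> V" using w XYZ dis by auto
  show ?thesis
  proof (cases "r = 2")
    case True
    then show ?thesis using uncovered_closed[OF cl sub] N t_ge by simp
  next
    case False
    then have "3 \<le> r" using N by simp
    then obtain A' B' W' where W': "path c (r - 2) A' B' W'" "W' \<subseteq> W" "A \<inter> W' = {}" "B \<inter> W' = {}"
      by (rule path_drop_both[OF W])
    have "state (opp c) (Suc (Suc u)) (r - 2)"
      by (rule stateI[OF cl, of _ A' B' W']) (use W' XYZ dis sub N in auto)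
    then show ?thesis by blast
  qed
qed

text \<open>\<open>B\<close> closes the path from \<open>J\<close> to \<open>K\<close> and is
  removed from its own path, so the total number of joints stays the same.\<close>

lemma state_of_absorbing:
  assumes W: "path c r A B W" and U: "path (opp c) u J K U" and dis: "W \<inter> U = {}" "W \<subseteq> V" "U \<subseteq> V"
    and N: "r + u + 1 = N" "2 \<le> r"
    and XY: "sized p X" "sized p Y" "X \<inter> Y = {}" "X \<union> Y \<subseteq> V - (W \<union> U)"
    and col: "\<chi> (B \<union> X \<union> J) = opp c" "\<chi> (B \<union> Y \<union> K) = opp c"
  shows "\<exists>c b r. state c b r"
proof -
  note w = path_basic[OF W] and u = path_basic[OF U]
  have "path (opp c) (Suc u) J B (U \<union> Y \<union> B)"
    by (rule path.step[OF U]) (use w u XY dis col in \<open>auto simp: Un_ac\<close>)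
  then have cl: "closed (opp c) (Suc u) (U \<union> Y \<union> B \<union> X)"
    by (rule closedI) (use w u XY dis col in \<open>auto simp: Un_ac\<close>)
  obtain B' W' where W': "path c (r - 1) A B' W'" "W' \<subseteq> W" "B \<inter> W' = {}"
    by (rule path_drop_last[OF W N(2)])
  have "state (opp c) (Suc u) (r - 1)"
    by (rule stateI[OF cl, of _ A B' W']) (use w W' XY dis N in auto)
  then show ?thesis by blast
qed

text \<open>Suppose neither path closes through \<open>Z\<close>. If the edges joining
  \<open>A\<close> to \<open>J\<close> and \<open>B\<close> to \<open>K\<close> agree in colour,
  they yield a crossing. If not, a diagonal edge shares an end with each of them and agrees with
  one; the shared end is then attached twice in the colour of the path it does not belong to, which
  absorbs it.\<close>

lemma state_of_pair:
  assumes W: "path c r A B W" and U: "path (opp c) u J K U" and dis: "W \<inter> U = {}" "W \<subseteq> V" "U \<subseteq> V"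
    and N: "r + u + 1 = N" "2 \<le> r" "2 \<le> u"
  shows "\<exists>c b r. state c b r"
proof -
  note w = path_basic[OF W] and u = path_basic[OF U]
  have "N * (l + p) = (r + u) * (l + p) + (l + p)" using N(1) by (metis add_mult_distrib mult_1)
  then have "p + p + p \<le> card (V - (W \<union> U))" using card_free[OF W U dis] by simp
  then obtain X Y Z where XYZ: "X \<subseteq> V - (W \<union> U)" "Y \<subseteq> V - (W \<union> U)" "Z \<subseteq> V - (W \<union> U)"
    "sized p X" "sized p Y" "sized p Z" "X \<inter> Y = {}" "X \<inter> Z = {}" "Y \<inter> Z = {}"
    by (rule obtain_sized3[rotated]) (use finite_V in auto)
  consider "\<chi> (A \<union> Z \<union> B) = c" | "\<chi> (J \<union> Z \<union> K) = opp c"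
    | "\<chi> (A \<union> Z \<union> B) = opp c" "\<chi> (J \<union> Z \<union> K) = c"
    by (metis not_colour_iff)
  then show ?thesis
  proof cases
    case 1
    have "closed c r (W \<union> Z)" by (rule closedI[OF W N(2)]) (use XYZ 1 in auto)
    then have "state c r u" by (rule stateI[OF _ U]) (use XYZ dis N in auto)
    then show ?thesis by blast
  next
    case 2
    have "closed (opp c) u (U \<union> Z)" by (rule closedI[OF U N(3)]) (use XYZ 2 in auto)
    then have "state (opp c) u r"
      by (rule stateI[of _ _ _ _ A B W]) (use XYZ dis N W in auto)
    then show ?thesis by blast
  next
    case 3
    have W'': "path (opp (opp c)) r A B W" using W by simp
    have N': "u + r + 1 = N" using N by simp
    have dis': "U \<inter> W = {}" using dis by auto
    note rw = path_rev[OF W] and ru = path_rev[OF U]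
    show ?thesis
    proof (cases "\<chi> (A \<union> X \<union> J) = c")
      case AXJ: True
      show ?thesis
      proof (cases "\<chi> (B \<union> Y \<union> K) = c")
        case True
        show ?thesis
          by (rule state_of_crossing[OF U W'' dis' dis(3,2) N' N(3), of X Y Z])
            (use XYZ AXJ True 3 in \<open>auto simp: Un_ac\<close>)
      next
        case BYK: False
        show ?thesis
        proof (cases "\<chi> (B \<union> Z \<union> J) = c")
          case True
          show ?thesis
            by (rule state_of_absorbing[OF ru W'' dis' dis(3,2) N' N(3), of X Z])
              (use XYZ AXJ True in \<open>auto simp: Un_ac\<close>)
        next
          case False
          show ?thesis
            by (rule state_of_absorbing[OF W U dis N(1,2), of Z Y])
              (use XYZ BYK False in \<open>auto simp: Un_ac not_colour_iff\<close>)
        qed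
      qed
    next
      case AXJ: False
      show ?thesis
      proof (cases "\<chi> (B \<union> Y \<union> K) = c")
        case False
        show ?thesis
          by (rule state_of_crossing[OF W U dis N(1,2), of X Y Z])
            (use XYZ AXJ False 3 in \<open>auto simp: not_colour_iff\<close>)
      next
        case BYK: True
        show ?thesis
        proof (cases "\<chi> (A \<union> Z \<union> K) = c")
          case True
          show ?thesis
            by (rule state_of_absorbing[OF U W'' dis' dis(3,2) N' N(3), of Z Y])
              (use XYZ BYK True in \<open>auto simp: Un_ac\<close>)
        next
          case False
          show ?thesis
            by (rule state_of_absorbing[OF rw U dis N(1,2), of X Z])
              (use XYZ AXJ False in \<open>auto simp: Un_ac not_colour_iff\<close>)
        qed
      qed
    qed
  qed
qed

text \<open>Two paths with \<open>N\<close> joints in all leave only \<open>2 * p\<close> vertices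
  free. Giving up one end joint makes room for the three private sets of
  \<open>state_of_pair\<close> and leaves the \<open>N - 1\<close> joints that a state has.\<close>

lemma state_exists: "\<exists>c b r. state c b r"
proof -
  obtain r u where "path_pair Blue r u" and N: "r + u = N" using path_pair_all by blast
  then obtain A B W J K U where W: "path Blue r A B W" and U: "path (opp Blue) u J K U"
    and dis: "W \<inter> U = {}" "W \<subseteq> V" "U \<subseteq> V"
    unfolding path_pair_def by blast
  note w = path_basic[OF W] and u = path_basic[OF U]
  consider "u = 1" | "r = 1" | "3 \<le> r" "2 \<le> u" | "2 \<le> r" "3 \<le> u"
    using w(1) u(1) N N_ge by linarith
  then show ?thesis
  proof cases
    case 1
    then show ?thesis using state_of_path[of Blue A B W] W dis N by auto
  next
    case 2
    then show ?thesis using state_of_path[of "opp Blue" J K U] U dis N by auto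
  next
    case 3
    then have "2 \<le> r" by simp
    then obtain B' W' where W': "path Blue (r - 1) A B' W'" "W' \<subseteq> W" "B \<inter> W' = {}"
      by (rule path_drop_last[OF W])
    show ?thesis by (rule state_of_pair[OF W'(1) U]) (use W' dis N 3 in auto)
  next
    case 4
    then have "2 \<le> u" by simp
    then obtain K' U' where U': "path (opp Blue) (u - 1) J K' U'" "U' \<subseteq> U" "K \<inter> U' = {}"
      by (rule path_drop_last[OF U])
    show ?thesis by (rule state_of_pair[OF W U'(1)]) (use U' dis N 4 in auto)
  qed
qed

end

section \<open>Cycles indexed periodically by the integers\<close>

context coloured_hypergraph
begin

text \<open>Periodic indexing spares a case distinction for arcs and chords that pass index 0.
  \<open>P i\<close> lies between \<open>S i\<close> and \<open>S (i + 1)\<close>.\<close>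

definition ring :: "colour \<Rightarrow> nat \<Rightarrow> (int \<Rightarrow> 'a set) \<Rightarrow> (int \<Rightarrow> 'a set) \<Rightarrow> bool" where
  "ring c b S P \<longleftrightarrow> 2 \<le> b \<and>
     (\<forall>i. sized l (S i) \<and> sized p (P i) \<and> \<chi> (S i \<union> P i \<union> S (i + 1)) = c) \<and>
     (\<forall>i j. i mod int b = j mod int b \<longrightarrow> S i = S j \<and> P i = P j) \<and>
     (\<forall>i j. i mod int b \<noteq> j mod int b \<longrightarrow> S i \<inter> S j = {} \<and> P i \<inter> P j = {}) \<and>
     (\<forall>i j. S i \<inter> P j = {})"

lemma closed_ring:
  assumes "closed c b C"
  obtains S P where "ring c b S P" "C = (\<Union>i. S i \<union> P i)"
proof -
  obtain X Y where XY: "cyclic_blocks c b X Y" and C: "C = (\<Union>i<b. X i \<union> Y i)"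
    by (rule closed_blocks[OF assms])
  have b: "2 \<le> b" using XY by (simp add: cyclic_blocks_def)
  define f where "f i = nat (i mod int b)" for i :: int
  have f: "f i < b" for i using b by (simp add: f_def nat_less_iff)
  have f_eq: "f i = f j \<longleftrightarrow> i mod int b = j mod int b" for i j
    using b by (simp add: f_def eq_nat_nat_iff)
  have f_Suc: "f (i + 1) = Suc (f i) mod b" for i
  proof -
    have "int (f (i + 1)) = int (Suc (f i) mod b)"
      using b by (simp add: f_def zmod_int mod_simps add.commute)
    then show ?thesis by simp
  qed
  show thesis
  proof
    show "ring c b (\<lambda>i. X (f i)) (\<lambda>i. Y (f i))"
      unfolding ring_def
    proof (intro conjI allI impI)
      fix i j :: int
      show "X (f i) = X (f j)" "Y (f i) = Y (f j)" if "i mod int b = j mod int b"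
        using that f_eq[of i j] by simp_all
      show "X (f i) \<inter> X (f j) = {}" "Y (f i) \<inter> Y (f j) = {}" if "i mod int b \<noteq> j mod int b"
        using that f_eq[of i j] f[of i] f[of j] XY by (simp_all add: cyclic_blocks_def)
    qed (use XY f f_Suc in \<open>simp_all add: cyclic_blocks_def\<close>)
    have "(\<Union>i. X (f i) \<union> Y (f i)) = (\<Union>i\<in>range f. X i \<union> Y i)" by auto
    also have "range f = {..<b}"
    proof (intro equalityI subsetI)
      fix k assume "k \<in> {..<b}"
      then have "k = f (int k)" by (simp add: f_def)
      then show "k \<in> range f" by blast
    qed (use f in auto)
    finally show "C = (\<Union>i. X (f i) \<union> Y (f i))" using C by simp
  qed
qed

text \<open>After reflection the private set with index \<open>i\<close> must lie between
  \<open>S (- i)\<close> and \<open>S (- i - 1)\<close>, whence the extra shift by one.\<close>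

lemma ring_reverse:
  assumes "ring c b S P"
  shows "ring c b (\<lambda>i. S (- i)) (\<lambda>i. P (- i - 1))"
proof -
  have neg: "x mod int b = y mod int b \<longleftrightarrow> i mod int b = j mod int b" if "x - y = - (i - j)" for x y i j
    unfolding mod_eq_dvd_iff that dvd_minus_iff ..
  have eq: "(- i) mod int b = (- j) mod int b \<longleftrightarrow> i mod int b = j mod int b"
    "(- i - 1) mod int b = (- j - 1) mod int b \<longleftrightarrow> i mod int b = j mod int b" for i j :: int
    by (rule neg; simp)+
  note r = assms[unfolded ring_def]
  have col: "\<chi> (S (- i) \<union> P (- i - 1) \<union> S (- (i + 1))) = c" for i
  proof -
    have "\<chi> (S (- i - 1) \<union> P (- i - 1) \<union> S (- i - 1 + 1)) = c" using r by blast
    moreover have "S (- i - 1) \<union> P (- i - 1) \<union> S (- i - 1 + 1) = S (- i) \<union> P (- i - 1) \<union> S (- (i + 1))"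
      by (simp add: Un_ac)
    ultimately show ?thesis by simp
  qed
  show ?thesis
    unfolding ring_def
  proof (intro conjI allI impI)
    fix i j :: int
    show "S (- i) = S (- j)" "P (- i - 1) = P (- j - 1)" if "i mod int b = j mod int b"
      using that eq[of i j] r by blast+
    show "S (- i) \<inter> S (- j) = {}" "P (- i - 1) \<inter> P (- j - 1) = {}" if "i mod int b \<noteq> j mod int b"
      using that eq[of i j] r by blast+
  qed (use r col in blast)+
qed

text \<open>The long way round from block \<open>i + m\<close> to \<open>S i\<close>. Its first
  joint may be any \<open>l\<close>-subset \<open>w\<close> of that block, because the remaining
  \<open>p\<close> vertices serve as private set and the first edge is the same set as before. For
  \<open>m = b\<close> the path has no edge that could make up for a change of joint, hence the last
  condition on \<open>w\<close>.\<close>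

lemma ring_arc:
  assumes R: "ring c b S P" and m: "1 \<le> m" "m \<le> b"
    and w: "sized l w" "w \<subseteq> S (i + int m) \<union> P (i + int m)" "w = S (i + int m) \<or> m < b"
  obtains K where "path c (b + 1 - m) w (S i) K" "K \<subseteq> (\<Union>i. S i \<union> P i)"
    "\<And>j. \<lbrakk>i < j; j < i + int m\<rbrakk> \<Longrightarrow> K \<inter> S j = {}"
    "\<And>j. \<lbrakk>i \<le> j; j < i + int m\<rbrakk> \<Longrightarrow> K \<inter> P j = {}"
proof -
  have ds: "S x \<inter> S y = {}" "P x \<inter> P y = {}" if "x \<noteq> y" "\<bar>x - y\<bar> < int b" for x y
    using R mod_neq_of_lt[OF that] unfolding ring_def by blast+
  have SP: "S x \<inter> P y = {}" and sS: "sized l (S x)" and sP: "sized p (P x)"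
    and col: "\<chi> (S x \<union> P x \<union> S (x + 1)) = c" for x y
    using R unfolding ring_def by blast+
  have Sb: "S (i + int b) = S i"
    using R mod_add_self2[of i "int b"] unfolding ring_def by blast
  define o' where "o' = i + int m"
  define X where "X k = (if k = 0 then w else S (o' + int k))" for k
  define Y where "Y k = (if k = 0 then (S o' \<union> P o') - w else P (o' + int k))" for k
  have w': "w \<subseteq> S o' \<union> P o'" using w(2) by (simp add: o'_def)
  have X_sub: "X k \<subseteq> S (o' + int k) \<union> (if k = 0 \<and> m < b then P o' else {})" for k
    using w w' by (auto simp: X_def o'_def)
  have Y_sub: "Y k \<subseteq> (if k = 0 then S o' else {}) \<union> P (o' + int k)" for k
    by (auto simp: Y_def)
  have X_sub': "X k \<subseteq> S (o' + int k) \<union> P o'" and Y_sub': "Y k \<subseteq> S o' \<union> P (o' + int k)" for k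
    using X_sub[of k] Y_sub[of k] by (auto split: if_splits)
  have SPo: "sized (l + p) (S o' \<union> P o')" using SP sS sP by (intro sized_Un) auto
  have "path c (Suc (b - m)) (X 0) (X (b - m)) ((\<Union>k\<le>b - m. X k) \<union> (\<Union>k<b - m. Y k))"
  proof (rule path_of_sequence)
    fix k assume "k \<le> b - m"
    show "sized l (X k)" using sS w by (simp add: X_def)
  next
    fix k assume "k < b - m"
    have "sized p (S o' \<union> P o' - w)"
      using SPo w(1) w' unfolding sized_def by (simp add: card_Diff_subset)
    then show "sized p (Y k)" using sP by (simp add: Y_def)
    have "X k \<union> Y k = S (o' + int k) \<union> P (o' + int k)" using w' by (auto simp: X_def Y_def)
    moreover have "X (Suc k) = S (o' + int k + 1)" by (simp add: X_def algebra_simps)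
    ultimately show "\<chi> (X k \<union> Y k \<union> X (Suc k)) = c" using col by simp
  next
    fix k k' assume k: "k \<le> b - m" "k' \<le> b - m" "k \<noteq> k'"
    then have "S (o' + int k) \<inter> S (o' + int k') = {}" using m by (intro ds) auto
    then show "X k \<inter> X k' = {}" using X_sub[of k] X_sub[of k'] SP[of "o' + int k" o'] SP[of "o' + int k'" o'] k(3)
      by (cases "k = 0"; cases "k' = 0"; cases "m < b"; simp; blast)
  next
    fix k k' assume k: "k < b - m" "k' < b - m" "k \<noteq> k'"
    then have "P (o' + int k) \<inter> P (o' + int k') = {}" using m by (intro ds) auto
    then show "Y k \<inter> Y k' = {}" using Y_sub[of k] Y_sub[of k'] SP[of o' "o' + int k"] SP[of o' "o' + int k'"] k(3)
      by (cases "k = 0"; cases "k' = 0"; simp; blast)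
  next
    fix k k' assume k: "k \<le> b - m" "k' < b - m"
    show "X k \<inter> Y k' = {}"
    proof (cases "k = k'")
      case True
      then show ?thesis using SP by (auto simp: X_def Y_def)
    next
      case False
      show ?thesis
      proof (cases "k = 0")
        case True
        then have "Y k' \<subseteq> P (o' + int k')" using False by (simp add: Y_def)
        moreover have "P o' \<inter> P (o' + int k') = {}" using m k False True by (intro ds) auto
        ultimately show ?thesis using X_sub'[of k] SP[of o' "o' + int k'"] True by auto
      next
        case nz: False
        then have "X k \<subseteq> S (o' + int k)" by (simp add: X_def)
        moreover have "S (o' + int k) \<inter> S o' = {}" using m k nz by (intro ds) auto
        ultimately show ?thesis using Y_sub'[of k'] SP[of "o' + int k" "o' + int k'"] by blast
      qed
    qed
  qed
  moreover have "X (b - m) = S i"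
  proof (cases "m = b")
    case True
    then show ?thesis using Sb w by (simp add: X_def)
  next
    case False
    then have "X (b - m) = S (i + int b)" using m by (simp add: X_def o'_def algebra_simps of_nat_diff)
    then show ?thesis using Sb by simp
  qed
  ultimately have pth: "path c (b + 1 - m) w (S i) ((\<Union>k\<le>b - m. X k) \<union> (\<Union>k<b - m. Y k))"
    using m by (simp add: Suc_diff_le X_def)
  show thesis
  proof (rule that[OF pth])
    have "X k \<subseteq> (\<Union>i. S i \<union> P i)" for k using X_sub'[of k] by blast
    moreover have "Y k \<subseteq> (\<Union>i. S i \<union> P i)" for k using Y_sub'[of k] by blast
    ultimately show "(\<Union>k\<le>b - m. X k) \<union> (\<Union>k<b - m. Y k) \<subseteq> (\<Union>i. S i \<union> P i)" by blast
  next
    fix j assume j: "i < j" "j < i + int m"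
    have *: "S (o' + int k) \<inter> S j = {}" if "k \<le> b - m" for k
      using j that m by (intro ds) (auto simp: o'_def)
    have 0: "S o' \<inter> S j = {}" using *[of 0] by simp
    have "X k \<inter> S j = {}" if "k \<le> b - m" for k
      using *[OF that] X_sub'[of k] SP[of j o'] by blast
    moreover have "Y k \<inter> S j = {}" for k
      using 0 Y_sub'[of k] SP[of j "o' + int k"] by blast
    ultimately show "((\<Union>k\<le>b - m. X k) \<union> (\<Union>k<b - m. Y k)) \<inter> S j = {}" by blast
  next
    fix j assume j: "i \<le> j" "j < i + int m"
    have *: "P (o' + int k) \<inter> P j = {}" if "k < b - m" for k
      using j that m by (intro ds) (auto simp: o'_def)
    have 0: "P o' \<inter> P j = {}" if "m < b" using *[of 0] that by simp
    have "X k \<inter> P j = {}" if "k \<le> b - m" for k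
    proof (cases "m < b")
      case True
      then show ?thesis using X_sub'[of k] SP[of "o' + int k" j] 0 by blast
    next
      case False
      then have "X k \<subseteq> S (o' + int k)" using X_sub[of k] by simp
      then show ?thesis using SP[of "o' + int k" j] by blast
    qed
    moreover have "Y k \<inter> P j = {}" if "k < b - m" for k
      using *[OF that] Y_sub'[of k] SP[of o' j] by blast
    ultimately show "((\<Union>k\<le>b - m. X k) \<union> (\<Union>k<b - m. Y k)) \<inter> P j = {}" by blast
  qed
qed

lemma ring_arc_rev:
  assumes R: "ring c b S P" and m: "1 \<le> m" "m \<le> b"
    and w: "sized l w" "w \<subseteq> S i \<union> P (i - 1)" "w = S i \<or> m < b"
  obtains K where "path c (b + 1 - m) w (S (i + int m)) K" "K \<subseteq> (\<Union>i. S i \<union> P i)"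
    "\<And>j. \<lbrakk>i < j; j < i + int m\<rbrakk> \<Longrightarrow> K \<inter> S j = {}"
    "\<And>j. \<lbrakk>i \<le> j; j < i + int m\<rbrakk> \<Longrightarrow> K \<inter> P j = {}"
proof -
  obtain K where K: "path c (b + 1 - m) w (S (- (- (i + int m)))) K"
    "K \<subseteq> (\<Union>i. S (- i) \<union> P (- i - 1))"
    "\<And>j. \<lbrakk>- (i + int m) < j; j < - (i + int m) + int m\<rbrakk> \<Longrightarrow> K \<inter> S (- j) = {}"
    "\<And>j. \<lbrakk>- (i + int m) \<le> j; j < - (i + int m) + int m\<rbrakk> \<Longrightarrow> K \<inter> P (- j - 1) = {}"
    by (rule ring_arc[OF ring_reverse[OF R] m w(1), of "- (i + int m)"]) (use w in auto)
  show thesis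
  proof (rule that[of K])
    show "path c (b + 1 - m) w (S (i + int m)) K" using K(1) by (simp add: add.commute)
    show "K \<subseteq> (\<Union>i. S i \<union> P i)" using K(2) by blast
    show "K \<inter> S j = {}" if "i < j" "j < i + int m" for j using K(3)[of "- j"] that by simp
    show "K \<inter> P j = {}" if "i \<le> j" "j < i + int m" for j using K(4)[of "- j - 1"] that by simp
  qed
qed

end

section \<open>A longest cycle and its chords\<close>

text \<open>Maximality ranges over states of both colours, since absorbing a joint of the cycle into
  \<open>R\<close> leads to a state whose cycle has colour \<open>opp c\<close>. Below, blue means
  \<open>c\<close> and red means \<open>opp c\<close>.\<close>

locale extremal = uncovered l p \<chi> V N t
  for l p :: nat and \<chi> :: "'a set \<Rightarrow> colour" and V :: "'a set" and N t :: nat +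
  fixes c :: colour and b r :: nat and S P :: "int \<Rightarrow> 'a set" and A B R :: "'a set"
  assumes ring: "ring c b S P" and R: "path (opp c) r A B R"
    and ring_V: "\<And>i. S i \<union> P i \<subseteq> V" and R_V: "R \<subseteq> V"
    and ring_R: "\<And>i. (S i \<union> P i) \<inter> R = {}" and N_eq: "b + r + 1 = N"
    and maximal: "\<And>c' b' r'. state c' b' r' \<Longrightarrow> b' \<le> b"
begin

definition C :: "'a set" where "C = (\<Union>i. S i \<union> P i)"

definition F :: "'a set" where "F = V - (C \<union> R)"

lemma b_ge2: "2 \<le> b"
  and sized_S: "sized l (S i)" and sized_P: "sized p (P i)"
  and ring_col: "\<chi> (S i \<union> P i \<union> S (i + 1)) = c"
  and S_cong: "i mod int b = j mod int b \<Longrightarrow> S i = S j"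
  and P_cong: "i mod int b = j mod int b \<Longrightarrow> P i = P j"
  and S_disj: "i mod int b \<noteq> j mod int b \<Longrightarrow> S i \<inter> S j = {}"
  and P_disj: "i mod int b \<noteq> j mod int b \<Longrightarrow> P i \<inter> P j = {}"
  and SP_disj: "S i \<inter> P j = {}"
  using ring unfolding ring_def by blast+

lemma S_C: "S i \<subseteq> C" and P_C: "P i \<subseteq> C" and C_V: "C \<subseteq> V" and C_R: "C \<inter> R = {}"
  using ring_V ring_R unfolding C_def by blast+

lemma closed_C: "closed c b C"
proof -
  obtain K where K: "path c (b + 1 - 1) (S (0 + int 1)) (S 0) K" "K \<subseteq> (\<Union>i. S i \<union> P i)"
    "\<And>j. \<lbrakk>0 \<le> j; j < 0 + int 1\<rbrakk> \<Longrightarrow> K \<inter> P j = {}"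
    by (rule ring_arc[OF ring, of 1 "S (0 + int 1)" 0]) (use b_ge2 sized_S in auto)
  have K0: "K \<inter> P 0 = {}" using K(3)[of 0] by simp
  have "closed c b (K \<union> P 0)"
    using K(1) K0 b_ge2 sized_P[of 0] ring_col[of 0]
    by (intro closedI) (auto simp: Un_ac)
  \<comment> \<open>Inclusion is clear, and counting forces equality, since \<open>C\<close> is a
    union of \<open>b\<close> blocks.\<close>
  moreover have "K \<union> P 0 = C"
  proof -
    have cl: "finite (K \<union> P 0)" "card (K \<union> P 0) = b * (l + p)"
      using closed_card[OF calculation] by auto
    have "C = (\<Union>i\<in>{0..<int b}. S i \<union> P i)"
    proof -
      have "S i \<union> P i = S (i mod int b) \<union> P (i mod int b)" for i
        using S_cong[of i "i mod int b"] P_cong[of i "i mod int b"] by simp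
      moreover have "i mod int b \<in> {0..<int b}" for i using b_ge2 by simp
      ultimately show ?thesis unfolding C_def by blast
    qed
    moreover have "card (\<Union>i\<in>{0..<int b}. S i \<union> P i) \<le> (\<Sum>i\<in>{0..<int b}. card (S i \<union> P i))"
      by (rule card_UN_le) simp
    moreover have "card (S i \<union> P i) = l + p" for i
      using sized_Un[OF sized_S sized_P SP_disj] by (simp add: sized_def)
    ultimately have "card C \<le> b * (l + p)" by simp
    moreover have "K \<union> P 0 \<subseteq> C" using K(2) by (auto simp: C_def)
    moreover have "finite C" using C_V finite_V finite_subset by blast
    ultimately show ?thesis using cl by (metis card_seteq)
  qed
  ultimately show ?thesis by simp
qed

lemma card_F: "finite F" "card F = l + p + p"
proof -
  note cl = closed_card[OF closed_C] and w = path_basic[OF R]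
  show "finite F" using finite_V by (simp add: F_def)
  have "card (C \<union> R) = card C + card R" using cl w C_R by (simp add: card_Un_disjoint)
  moreover have "card F = card V - card (C \<union> R)"
    unfolding F_def using C_V R_V cl w by (intro card_Diff_subset) auto
  moreover have "N * (l + p) = b * (l + p) + r * (l + p) + (l + p)"
    unfolding N_eq[symmetric] by (simp add: algebra_simps)
  ultimately show "card F = l + p + p" using cl w(7) card_V by simp
qed

lemma F_disj: "F \<inter> C = {}" "F \<inter> R = {}" "F \<subseteq> V"
  by (auto simp: F_def)

text \<open>The blue cycle together with a degenerate red one must miss more than \<open>t\<close>
  blocks, so \<open>r > t\<close>.\<close>

lemma r_ge3: "3 \<le> r"
proof -
  have "card (V - C) = card V - card C"
    using closed_card[OF closed_C] C_V by (intro card_Diff_subset) auto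
  moreover have "N * (l + p) = b * (l + p) + (r * (l + p) + (l + p))"
    unfolding N_eq[symmetric] by (simp add: algebra_simps)
  ultimately have "l + p \<le> card (V - C)"
    using closed_card[OF closed_C] card_V by simp
  then obtain X where "X \<subseteq> V - C" "sized (l + p) X"
    by (rule obtain_sized[rotated]) (use finite_V in auto)
  then have "b + 1 + t < N"
    using closed_C C_V by (intro uncovered[of c b C 1 X]) (auto simp: cover_cycle_def)
  then show ?thesis using N_eq t_ge by simp
qed

text \<open>A red edge would close the red path, and the two cycles would miss only one
  block.\<close>

lemma end_col:
  assumes "path (opp c) r E E' R" "Y \<subseteq> F" "sized p Y"
  shows "\<chi> (E \<union> Y \<union> E') = c"
proof (rule ccontr)
  assume "\<chi> (E \<union> Y \<union> E') \<noteq> c"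
  then have "closed (opp c) r (R \<union> Y)"
    using assms r_ge3 F_disj by (intro closedI) (auto simp: not_colour_iff)
  then have "b + r + t < N"
    using closed_C C_R C_V R_V F_disj assms(2)
    by (intro uncovered_closed2[of c b C r "R \<union> Y"]) auto
  then show False using N_eq t_ge by simp
qed

text \<open>Otherwise \<open>E\<close> could be inserted between \<open>S i\<close> and
  \<open>S (i + 1)\<close>, against maximality. The insertion removes the edge through
  \<open>P i\<close>, so \<open>X\<close> and \<open>Y\<close> may use its vertices.\<close>

lemma insert_one:
  assumes E: "path (opp c) r E E' R" and X: "X \<subseteq> F \<union> P i" "sized p X" and Y: "Y \<subseteq> F \<union> P i" "sized p Y"
    and "X \<inter> Y = {}"
  shows "\<not> (\<chi> (S i \<union> X \<union> E) = c \<and> \<chi> (S (i + 1) \<union> Y \<union> E) = c)"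
proof
  assume col: "\<chi> (S i \<union> X \<union> E) = c \<and> \<chi> (S (i + 1) \<union> Y \<union> E) = c"
  obtain K where K: "path c (b + 1 - 1) (S (i + int 1)) (S i) K" "K \<subseteq> (\<Union>i. S i \<union> P i)"
    "\<And>j. \<lbrakk>i \<le> j; j < i + int 1\<rbrakk> \<Longrightarrow> K \<inter> P j = {}"
    by (rule ring_arc[OF ring, of 1 "S (i + int 1)" i]) (use b_ge2 sized_S in auto)
  have KP: "K \<inter> P i = {}" using K(3)[of i] by simp
  have KC: "K \<subseteq> C" using K(2) by (simp add: C_def)
  note e = path_basic[OF E]
  have PC: "P i \<subseteq> C" by (rule P_C)
  have d: "X \<inter> K = {}" "Y \<inter> K = {}" "E \<inter> K = {}" "X \<inter> E = {}" "Y \<inter> E = {}"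
    using X Y KP KC PC F_disj C_R e(2) by blast+
  have "path c (Suc b) (S (i + 1)) E (K \<union> X \<union> E)"
    by (rule path.step) (use K(1) X(2) e(4) d col in auto)
  then have cl: "closed c (Suc b) (K \<union> X \<union> E \<union> Y)"
    by (rule closedI) (use b_ge2 Y(2) d \<open>X \<inter> Y = {}\<close> col in auto)
  obtain A' W' where W': "path (opp c) (r - 1) A' E' W'" "W' \<subseteq> R" "E \<inter> W' = {}"
    by (rule path_drop_first[OF E]) (use r_ge3 in simp)
  have sub: "X \<union> Y \<subseteq> V - R" using X Y F_disj PC C_V C_R by blast
  have "state c (Suc b) (r - 1)"
  proof (rule stateI[OF cl W'(1)])
    show "(K \<union> X \<union> E \<union> Y) \<inter> W' = {}" using sub W' KC C_R by blast
    show "K \<union> X \<union> E \<union> Y \<subseteq> V" using sub KC C_V e(2) R_V by blast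
  qed (use W' R_V r_ge3 N_eq in auto)
  then show False using maximal by fastforce
qed

text \<open>Here both ends would be inserted in place of \<open>P i\<close>. The edge between them
  is blue by \<open>end_col\<close>, which is why \<open>Y\<close> must lie in
  \<open>F\<close>.\<close>

lemma insert_two:
  assumes E: "path (opp c) r E E' R" and X: "X \<subseteq> F \<union> P i" "sized p X" and Y: "Y \<subseteq> F" "sized p Y"
    and Z: "Z \<subseteq> F \<union> P i" "sized p Z" and XYZ: "X \<inter> Y = {}" "X \<inter> Z = {}" "Y \<inter> Z = {}"
  shows "\<not> (\<chi> (S i \<union> X \<union> E) = c \<and> \<chi> (S (i + 1) \<union> Z \<union> E') = c)"
proof
  assume col: "\<chi> (S i \<union> X \<union> E) = c \<and> \<chi> (S (i + 1) \<union> Z \<union> E') = c"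
  obtain K where K: "path c (b + 1 - 1) (S (i + int 1)) (S i) K" "K \<subseteq> (\<Union>i. S i \<union> P i)"
    "\<And>j. \<lbrakk>i \<le> j; j < i + int 1\<rbrakk> \<Longrightarrow> K \<inter> P j = {}"
    by (rule ring_arc[OF ring, of 1 "S (i + int 1)" i]) (use b_ge2 sized_S in auto)
  have KP: "K \<inter> P i = {}" using K(3)[of i] by simp
  have KC: "K \<subseteq> C" using K(2) by (simp add: C_def)
  note e = path_basic[OF E]
  have PC: "P i \<subseteq> C" by (rule P_C)
  have EE: "E \<inter> E' = {}" using e r_ge3 by simp
  have d: "X \<inter> K = {}" "Y \<inter> K = {}" "Z \<inter> K = {}" "E \<inter> K = {}" "E' \<inter> K = {}" "X \<inter> E = {}" "Y \<inter> E = {}"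
    "Z \<inter> E = {}" "X \<inter> E' = {}" "Y \<inter> E' = {}" "Z \<inter> E' = {}"
    using X Y Z KP KC PC F_disj C_R e(2,3) by blast+
  have "path c (Suc b) (S (i + 1)) E (K \<union> X \<union> E)"
    by (rule path.step) (use K(1) X(2) e(4) d col in auto)
  then have "path c (Suc (Suc b)) (S (i + 1)) E' (K \<union> X \<union> E \<union> Y \<union> E')"
    by (rule path.step) (use Y(2) e(5) d EE XYZ end_col[OF E Y] in auto)
  then have cl: "closed c (Suc (Suc b)) (K \<union> X \<union> E \<union> Y \<union> E' \<union> Z)"
    by (rule closedI) (use b_ge2 Z(2) d XYZ col in auto)
  obtain A' B' W' where W': "path (opp c) (r - 2) A' B' W'" "W' \<subseteq> R" "E \<inter> W' = {}" "E' \<inter> W' = {}"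
    by (rule path_drop_both[OF E r_ge3])
  have sub: "X \<union> Y \<union> Z \<subseteq> V - R" using X Y Z F_disj PC C_V C_R by blast
  have "state c (Suc (Suc b)) (r - 2)"
  proof (rule stateI[OF cl W'(1)])
    show "(K \<union> X \<union> E \<union> Y \<union> E' \<union> Z) \<inter> W' = {}" using sub W' KC C_R by blast
    show "K \<union> X \<union> E \<union> Y \<union> E' \<union> Z \<subseteq> V" using sub KC C_V e(2,3) R_V by blast
  qed (use W' R_V r_ge3 N_eq in auto)
  then show False using maximal by fastforce
qed

section \<open>Absorbing joints of the cycle into the red path\<close>

lemma obtain_free_pair:
  obtains Q Q' where "Q \<subseteq> F" "Q' \<subseteq> F" "sized p Q" "sized p Q'" "Q \<inter> Q' = {}"
  by (rule obtain_sized2[OF card_F(1), of p p]) (use card_F(2) in auto)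

text \<open>Take the private sets \<open>Q\<close>, \<open>Q'\<close> and \<open>P i\<close>. If a
  joint is not absorbable, then all three join it to one of the ends in blue, or the same two of
  them join it to both ends in blue. By \<open>insert_one\<close>, an end with two blue sets at
  \<open>i\<close> has none at \<open>i + 1\<close>. Hence the second alternative at
  \<open>i\<close> leaves no blue set at all at \<open>i + 1\<close>, which is impossible there; in
  the first, one end has all three sets at \<open>i\<close> and the other end all three at
  \<open>i + 1\<close>, against \<open>insert_two\<close>.\<close>

lemma absorbable:
  "\<exists>j X Y. (j = i \<or> j = i + 1) \<and> X \<subseteq> F \<union> P i \<and> Y \<subseteq> F \<union> P i \<and> sized p X \<and> sized p Y \<and>
    X \<inter> Y = {} \<and> \<chi> (S j \<union> X \<union> A) = opp c \<and> \<chi> (S j \<union> Y \<union> B) = opp c" (is ?thesis)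
proof (rule ccontr)
  assume neg: "\<not> ?thesis"
  obtain Q Q' where Q: "Q \<subseteq> F" "Q' \<subseteq> F" "sized p Q" "sized p Q'" "Q \<inter> Q' = {}"
    by (rule obtain_free_pair)
  define T where "T X Y \<longleftrightarrow> X \<subseteq> F \<union> P i \<and> Y \<subseteq> F \<union> P i \<and> sized p X \<and> sized p Y \<and> X \<inter> Y = {}" for X Y
  have QP: "Q \<inter> P i = {}" "Q' \<inter> P i = {}" using Q F_disj P_C by blast+
  have T: "T Q Q'" "T Q' Q" "T Q (P i)" "T (P i) Q" "T Q' (P i)" "T (P i) Q'"
    using Q QP sized_P unfolding T_def by auto
  define blue where "blue j X E \<longleftrightarrow> \<chi> (S j \<union> X \<union> E) = c" for j X E
  have no: "blue j X A \<or> blue j Y B" if "T X Y" "j = i \<or> j = i + 1" for j X Y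
  proof -
    have "\<not> (\<chi> (S j \<union> X \<union> A) = opp c \<and> \<chi> (S j \<union> Y \<union> B) = opp c)"
      using neg that unfolding T_def by blast
    then show ?thesis unfolding blue_def by (simp add: not_opp_iff)
  qed
  have one: "\<not> (blue i X E \<and> blue (i + 1) Y E)" if "T X Y" "E = A \<or> E = B" for X Y E
    using insert_one[OF R, of X i Y] insert_one[OF path_rev[OF R], of X i Y] that
    unfolding T_def blue_def by blast
  have two: "\<not> (blue i Q A \<and> blue (i + 1) (P i) B)" "\<not> (blue i Q B \<and> blue (i + 1) (P i) A)"
    using insert_two[OF R, of Q i Q' "P i"] insert_two[OF path_rev[OF R], of Q i Q' "P i"] Q QP sized_P
    unfolding blue_def by blast+
  have nos: "blue i Q A \<or> blue i Q' B" "blue i Q' A \<or> blue i Q B" "blue i Q A \<or> blue i (P i) B"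
    "blue i (P i) A \<or> blue i Q B" "blue i Q' A \<or> blue i (P i) B" "blue i (P i) A \<or> blue i Q' B"
    "blue (i+1) Q A \<or> blue (i+1) Q' B" "blue (i+1) Q' A \<or> blue (i+1) Q B"
    "blue (i+1) Q A \<or> blue (i+1) (P i) B" "blue (i+1) (P i) A \<or> blue (i+1) Q B"
    "blue (i+1) Q' A \<or> blue (i+1) (P i) B" "blue (i+1) (P i) A \<or> blue (i+1) Q' B"
    using no T by blast+
  have ones: "\<not> (blue i Q E \<and> blue (i + 1) Q' E)" "\<not> (blue i Q' E \<and> blue (i + 1) Q E)"
    "\<not> (blue i Q E \<and> blue (i + 1) (P i) E)" "\<not> (blue i (P i) E \<and> blue (i + 1) Q E)"
    "\<not> (blue i Q' E \<and> blue (i + 1) (P i) E)" "\<not> (blue i (P i) E \<and> blue (i + 1) Q' E)"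
    if "E = A \<or> E = B" for E using one T that by blast+
  show False using nos ones[OF disjI1[OF refl]] ones[OF disjI2[OF refl]] two by satx
qed

lemma absorbableE:
  obtains j X Y where "j = i \<or> j = i + 1" "X \<subseteq> F \<union> P i" "Y \<subseteq> F \<union> P i" "sized p X" "sized p Y"
    "X \<inter> Y = {}" "\<chi> (S j \<union> X \<union> A) = opp c" "\<chi> (S j \<union> Y \<union> B) = opp c"
  using absorbable[of i] by blast

lemma closed_absorb:
  assumes X: "X \<subseteq> F \<union> C" "sized p X" and Y: "Y \<subseteq> F \<union> C" "sized p Y" and "X \<inter> Y = {}"
    and SXY: "S j \<inter> X = {}" "S j \<inter> Y = {}"
    and col: "\<chi> (S j \<union> X \<union> A) = opp c" "\<chi> (S j \<union> Y \<union> B) = opp c"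
  shows "closed (opp c) (Suc r) (R \<union> Y \<union> S j \<union> X)"
proof -
  note w = path_basic[OF R]
  have d: "X \<inter> R = {}" "Y \<inter> R = {}" "S j \<inter> R = {}" using X Y F_disj C_R S_C[of j] by blast+
  have "path (opp c) (Suc r) A (S j) (R \<union> Y \<union> S j)"
    by (rule path.step[OF R]) (use d SXY Y sized_S col in \<open>auto simp: Un_ac\<close>)
  then show ?thesis
    by (rule closedI) (use d SXY X \<open>X \<inter> Y = {}\<close> r_ge3 col in \<open>auto simp: Un_ac\<close>)
qed

text \<open>Absorbing a joint turns the pair into a red cycle with \<open>r + 1\<close> joints and a
  blue path with \<open>b - 1\<close>, again a state, so maximality applies to the red
  cycle.\<close>

lemma b_ge: "Suc r \<le> b"
proof -
  obtain j X Y where j: "j = 0 \<or> j = 0 + 1" and X: "X \<subseteq> F \<union> P 0" "Y \<subseteq> F \<union> P 0" "sized p X" "sized p Y"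
    "X \<inter> Y = {}" and col: "\<chi> (S j \<union> X \<union> A) = opp c" "\<chi> (S j \<union> Y \<union> B) = opp c"
    by (rule absorbableE)
  have XY: "S j \<inter> X = {}" "S j \<inter> Y = {}" "X \<subseteq> F \<union> C" "Y \<subseteq> F \<union> C"
    using X F_disj S_C[of j] P_C[of 0] SP_disj[of j 0] by blast+
  have cl: "closed (opp c) (Suc r) (R \<union> Y \<union> S j \<union> X)"
    by (rule closed_absorb) (use XY X col in auto)
  \<comment> \<open>This arc omits \<open>S j\<close> and the private sets on both sides of it. As
    \<open>j\<close> is 0 or 1, one of these is \<open>P 0\<close>, which the absorption may
    use.\<close>
  obtain K where K: "path c (b + 1 - 2) (S (j - 1 + int 2)) (S (j - 1)) K" "K \<subseteq> (\<Union>i. S i \<union> P i)"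
    "\<And>h. \<lbrakk>j - 1 < h; h < j - 1 + int 2\<rbrakk> \<Longrightarrow> K \<inter> S h = {}"
    "\<And>h. \<lbrakk>j - 1 \<le> h; h < j - 1 + int 2\<rbrakk> \<Longrightarrow> K \<inter> P h = {}"
    by (rule ring_arc[OF ring, of 2 "S (j - 1 + int 2)" "j - 1"]) (use b_ge2 sized_S in auto)
  have KC: "K \<subseteq> C" "K \<inter> S j = {}" "K \<inter> P 0 = {}"
    using K(2) K(3)[of j] K(4)[of 0] j by (auto simp: C_def)
  have pc: "path (opp (opp c)) (b - 1) (S (j - 1 + int 2)) (S (j - 1)) K" using K(1) b_ge2 by simp
  have "state (opp c) (Suc r) (b - 1)"
  proof (rule stateI[OF cl pc])
    show "(R \<union> Y \<union> S j \<union> X) \<inter> K = {}" using KC C_R F_disj X by blast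
    show "R \<union> Y \<union> S j \<union> X \<subseteq> V" "K \<subseteq> V" using KC C_V R_V F_disj XY S_C[of j] by blast+
  qed (use b_ge2 N_eq in auto)
  then show ?thesis by (rule maximal)
qed

text \<open>If the edge were blue, \<open>K\<close> would close to a blue cycle disjoint from the
  red cycle that absorbs \<open>S j\<close>. The two would miss \<open>b - n\<close> blocks, at most
  \<open>t\<close>.\<close>

lemma chord_col:
  assumes K: "path c n u v K" "2 \<le> n" "b \<le> n + t" "K \<subseteq> C" "K \<inter> S j = {}"
    and X: "X \<subseteq> F \<union> C - K" "sized p X" and Y: "Y \<subseteq> F \<union> C - K" "sized p Y"
    and Z: "Z \<subseteq> F \<union> C - K" "sized p Z"
    and XYZ: "X \<inter> Y = {}" "X \<inter> Z = {}" "Y \<inter> Z = {}"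
    and SXYZ: "S j \<inter> X = {}" "S j \<inter> Y = {}" "S j \<inter> Z = {}"
    and col: "\<chi> (S j \<union> X \<union> A) = opp c" "\<chi> (S j \<union> Y \<union> B) = opp c"
  shows "\<chi> (u \<union> Z \<union> v) = opp c"
proof (rule ccontr)
  assume *: "\<chi> (u \<union> Z \<union> v) \<noteq> opp c"
  have cl: "closed (opp c) (Suc r) (R \<union> Y \<union> S j \<union> X)"
    by (rule closed_absorb) (use X Y XYZ SXYZ col in auto)
  have clK: "closed c n (K \<union> Z)"
    by (rule closedI) (use K Z * in \<open>auto simp: not_opp_iff\<close>)
  have "n + Suc r + t < N"
  proof (rule uncovered_closed2[OF clK cl])
    have "K \<inter> R = {}" "K \<inter> Y = {}" "K \<inter> X = {}" "Z \<inter> R = {}"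
      using K(4) X(1) Y(1) Z(1) C_R F_disj by blast+
    then show "(K \<union> Z) \<inter> (R \<union> Y \<union> S j \<union> X) = {}"
      using K(5) XYZ SXYZ by (simp add: Int_Un_distrib Int_Un_distrib2 Int_commute)
    show "K \<union> Z \<subseteq> V" "R \<union> Y \<union> S j \<union> X \<subseteq> V"
      using K(4) X(1) Y(1) Z(1) C_V R_V F_disj S_C[of j] by blast+
  qed
  then show False using K(3) N_eq by simp
qed

text \<open>Both \<open>j0\<close> and \<open>j0 + 1\<close> lie strictly inside the gap, so
  whichever of them is absorbable is not on \<open>K\<close>. The absorption may consume
  \<open>P j0\<close>, so the chord has to use another private set of the gap.\<close>

lemma chord_col_mid:
  assumes m: "3 \<le> m" "m \<le> t + 1" "m < b" and j0: "i < j0" "j0 + 1 < i + int m"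
    and h: "i \<le> h" "h < i + int m" "h \<noteq> j0"
    and K: "path c (b + 1 - m) u v K" "K \<subseteq> (\<Union>i. S i \<union> P i)"
    "\<And>j. \<lbrakk>i < j; j < i + int m\<rbrakk> \<Longrightarrow> K \<inter> S j = {}"
    "\<And>j. \<lbrakk>i \<le> j; j < i + int m\<rbrakk> \<Longrightarrow> K \<inter> P j = {}"
  shows "\<chi> (u \<union> P h \<union> v) = opp c"
proof -
  obtain j X Y where j: "j = j0 \<or> j = j0 + 1" and X: "X \<subseteq> F \<union> P j0" "Y \<subseteq> F \<union> P j0" "sized p X" "sized p Y"
    "X \<inter> Y = {}" and col: "\<chi> (S j \<union> X \<union> A) = opp c" "\<chi> (S j \<union> Y \<union> B) = opp c"
    by (rule absorbableE)
  have KC: "K \<subseteq> C" "K \<inter> S j = {}" "K \<inter> P j0 = {}" "K \<inter> P h = {}"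
    using K(2) K(3)[of j] K(4)[of j0] K(4)[of h] j0 j h by (auto simp: C_def)
  have "j0 mod int b \<noteq> h mod int b" using j0 h m by (intro mod_neq_of_lt) auto
  then have PP: "P j0 \<inter> P h = {}" by (rule P_disj)
  have KF: "K \<inter> F = {}" using KC F_disj by blast
  show ?thesis
  proof (rule chord_col[OF K(1) _ _ KC(1,2) _ X(3) _ X(4) _ sized_P X(5) _ _ _ _ _ col])
    show "X \<subseteq> F \<union> C - K" "Y \<subseteq> F \<union> C - K" "P h \<subseteq> F \<union> C - K"
      using X(1,2) KC KF P_C[of j0] P_C[of h] by blast+
    show "X \<inter> P h = {}" "Y \<inter> P h = {}" using X(1,2) PP F_disj P_C[of h] by blast+
    show "S j \<inter> X = {}" "S j \<inter> Y = {}" using X(1,2) F_disj S_C[of j] SP_disj[of j j0] by blast+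
  qed (use m SP_disj in auto)
qed

lemma chord:
  assumes "3 \<le> m" "m \<le> t + 1" "m < b" "i < j0" "j0 + 1 < i + int m" "i \<le> h" "h < i + int m" "h \<noteq> j0"
    and w: "sized l w" "w \<subseteq> S (i + int m) \<union> P (i + int m)"
  shows "\<chi> (S i \<union> P h \<union> w) = opp c"
proof -
  obtain K where K: "path c (b + 1 - m) w (S i) K" "K \<subseteq> (\<Union>i. S i \<union> P i)"
    "\<And>j. \<lbrakk>i < j; j < i + int m\<rbrakk> \<Longrightarrow> K \<inter> S j = {}"
    "\<And>j. \<lbrakk>i \<le> j; j < i + int m\<rbrakk> \<Longrightarrow> K \<inter> P j = {}"
    by (rule ring_arc[OF ring, of m w i]) (use assms in auto)
  have "\<chi> (w \<union> P h \<union> S i) = opp c" by (rule chord_col_mid[OF assms(1-8) K])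
  then show ?thesis by (simp add: Un_ac)
qed

lemma chord_rev:
  assumes "3 \<le> m" "m \<le> t + 1" "m < b" "i < j0" "j0 + 1 < i + int m" "i \<le> h" "h < i + int m" "h \<noteq> j0"
    and w: "sized l w" "w \<subseteq> S i \<union> P (i - 1)"
  shows "\<chi> (w \<union> P h \<union> S (i + int m)) = opp c"
proof -
  obtain K where K: "path c (b + 1 - m) w (S (i + int m)) K" "K \<subseteq> (\<Union>i. S i \<union> P i)"
    "\<And>j. \<lbrakk>i < j; j < i + int m\<rbrakk> \<Longrightarrow> K \<inter> S j = {}"
    "\<And>j. \<lbrakk>i \<le> j; j < i + int m\<rbrakk> \<Longrightarrow> K \<inter> P j = {}"
    by (rule ring_arc_rev[OF ring, of m w i]) (use assms in auto)
  show ?thesis by (rule chord_col_mid[OF assms(1-8) K])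
qed

lemma b_ge4: "4 \<le> b" using b_ge r_ge3 by simp

lemma chord3: "\<chi> (S i \<union> P i \<union> S (i + 3)) = opp c"
  using chord[of 3 i "i + 1" i "S (i + 3)"] b_ge4 t_ge sized_S by simp

lemma chord4: "3 \<le> t \<Longrightarrow> 5 \<le> b \<Longrightarrow> \<chi> (S i \<union> P i \<union> S (i + 4)) = opp c"
  using chord[of 4 i "i + 1" i "S (i + 4)"] sized_S by simp

text \<open>The freedom in \<open>h\<close> matters when chords are combined into a path, because
  one of \<open>P i\<close> and \<open>P (i + 2)\<close> may already be taken.\<close>

lemma chord3_low:
  assumes "sized l w" "w \<subseteq> P (i + 3)" "h = i \<or> h = i + 2"
  shows "\<chi> (S i \<union> P h \<union> w) = opp c"
proof -
  have "w \<subseteq> S (i + int 3) \<union> P (i + int 3)" using assms(2) by auto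
  then show ?thesis using chord[of 3 i "i + 1" h w] assms(1,3) b_ge4 t_ge by auto
qed

lemma chord3_high:
  assumes "sized l w" "w \<subseteq> P (i - 1)" "h = i \<or> h = i + 2"
  shows "\<chi> (w \<union> P h \<union> S (i + 3)) = opp c"
proof -
  have "w \<subseteq> S i \<union> P (i - 1)" using assms(2) by auto
  then show ?thesis using chord_rev[of 3 i "i + 1" h w] assms(1,3) b_ge4 t_ge by auto
qed

lemma S_add_b: "S (i + int b * x) = S i" and P_add_b: "P (i + int b * x) = P i"
  by (rule S_cong P_cong; simp)+

text \<open>Every edge uses the private set that follows its first joint, so distinct positions give
  disjoint private sets, and the one at the last joint stays free.\<close>

lemma ring_path:
  fixes pos :: "nat \<Rightarrow> int"
  assumes inj: "\<And>k k'. \<lbrakk>k \<le> n; k' \<le> n; k \<noteq> k'\<rbrakk> \<Longrightarrow> pos k mod int b \<noteq> pos k' mod int b"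
    and col: "\<And>k. k < n \<Longrightarrow> \<chi> (S (pos k) \<union> P (pos k) \<union> S (pos (Suc k))) = opp c"
  obtains Z where "path (opp c) (Suc n) (S (pos 0)) (S (pos n)) Z" "Z \<subseteq> C" "Z \<inter> P (pos n) = {}"
proof (rule that)
  let ?Z = "(\<Union>k\<le>n. S (pos k)) \<union> (\<Union>k<n. P (pos k))"
  show "path (opp c) (Suc n) (S (pos 0)) (S (pos n)) ?Z"
    by (rule path_of_sequence) (use sized_S sized_P SP_disj col inj S_disj P_disj in auto)
  show "?Z \<subseteq> C" using S_C P_C by blast
  have "P (pos k) \<inter> P (pos n) = {}" if "k < n" for k
    using that by (intro P_disj inj) auto
  then show "?Z \<inter> P (pos n) = {}" using SP_disj by blast
qed

section \<open>Paths along chords\<close>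

text \<open>Only even shifts \<open>h\<close> are useful: the joints that can be attached to the ends of \<open>R\<close> may be
  those of one parity.\<close>
definition zigzag :: "int \<Rightarrow> bool" where
  "zigzag h \<longleftrightarrow> (\<forall>s. \<exists>Z. path (opp c) (b - 1) (S s) (S (s + h)) Z \<and> Z \<subseteq> C)"

text \<open>Steps of three reach every joint. Stopping one joint early ends at
  \<open>s + 3 * (b - 2)\<close>, that is at \<open>s - 6\<close>; using all joints would end at
  \<open>s - 3\<close>, an odd shift.\<close>

lemma zigzag_coprime:
  assumes "\<not> 3 dvd b"
  shows "zigzag (- 6)"
  unfolding zigzag_def
proof
  fix s :: int
  have nd: "\<not> 3 dvd int b" using assms by presburger
  have inj: "(s + 3 * int k) mod int b \<noteq> (s + 3 * int k') mod int b"
    if "k \<le> b - 2" "k' \<le> b - 2" "k \<noteq> k'" for k k'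
  proof
    assume "(s + 3 * int k) mod int b = (s + 3 * int k') mod int b"
    then have "int b dvd 3 * (int k - int k')" by (simp add: mod_eq_dvd_iff algebra_simps)
    then have "int b dvd int k - int k'" by (rule dvd_of_dvd_three_times[OF nd])
    then have "int k mod int b = int k' mod int b" by (simp add: mod_eq_dvd_iff)
    then show False using that b_ge4 by simp
  qed
  have col: "\<chi> (S (s + 3 * int k) \<union> P (s + 3 * int k) \<union> S (s + 3 * int (Suc k))) = opp c" for k
    using chord3[of "s + 3 * int k"] by (simp add: algebra_simps)
  obtain Z where Z: "path (opp c) (Suc (b - 2)) (S (s + 3 * int 0)) (S (s + 3 * int (b - 2))) Z" "Z \<subseteq> C"
    by (rule ring_path[of "b - 2" "\<lambda>k. s + 3 * int k"]) (use inj col in auto)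
  have "s + 3 * int (b - 2) = s + - 6 + int b * 3" using b_ge4 by simp
  then have "S (s + 3 * int (b - 2)) = S (s + - 6)" using S_add_b[of "s + - 6" 3] by metis
  moreover have "Suc (b - 2) = b - 1" using b_ge4 by simp
  ultimately show "\<exists>Z. path (opp c) (b - 1) (S s) (S (s + - 6)) Z \<and> Z \<subseteq> C"
    using Z by (intro exI[of _ Z]) simp
qed

lemma zigzag_chord4:
  assumes q: "b = 3 * q" and "3 \<le> t"
  shows "zigzag (- 4)"
  unfolding zigzag_def
proof
  fix s :: int
  have q2: "2 \<le> q" using q b_ge4 by simp
  \<comment> \<open>The three residue classes are traversed one after the other;
    \<open>k div q\<close> counts the changes of class, each made by a step of four.\<close>
  define pos where "pos k = s + 3 * int k + int (k div q)" for k
  have pos_eq: "pos k mod int b = (s + (3 * int (k mod q) + int (k div q))) mod int b" for k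
  proof -
    have "int k = int q * int (k div q) + int (k mod q)" by (metis mult_div_mod_eq of_nat_add of_nat_mult)
    then have "3 * int k = int b * int (k div q) + 3 * int (k mod q)" using q by (simp add: algebra_simps)
    then have "pos k = s + (3 * int (k mod q) + int (k div q)) + int b * int (k div q)"
      unfolding pos_def by linarith
    then show ?thesis by simp
  qed
  have inj: "pos k mod int b \<noteq> pos k' mod int b" if "k \<le> b - 2" "k' \<le> b - 2" "k \<noteq> k'" for k k'
  proof -
    have k: "k div q < 3" "k' div q < 3" using that q q2 by (auto simp: div_less_iff_less_mult)
    have kq: "k mod q < q" "k' mod q < q" using q2 by auto
    have "3 * int (k mod q) + int (k div q) \<noteq> 3 * int (k' mod q) + int (k' div q)"
    proof
      assume "3 * int (k mod q) + int (k div q) = 3 * int (k' mod q) + int (k' div q)"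
      then have eq: "3 * (k mod q) + k div q = 3 * (k' mod q) + k' div q" by linarith
      have "k mod q = (3 * (k mod q) + k div q) div 3" "k' mod q = (3 * (k' mod q) + k' div q) div 3"
        using k by simp_all
      then have "k mod q = k' mod q" using eq by metis
      with eq have "k mod q = k' mod q \<and> k div q = k' div q" by simp
      then show False using that(3) by (metis mult_div_mod_eq)
    qed
    moreover have "\<bar>(3 * int (k mod q) + int (k div q)) - (3 * int (k' mod q) + int (k' div q))\<bar> < int b"
      using k kq q by linarith
    ultimately show ?thesis unfolding pos_eq by (intro mod_neq_of_lt) auto
  qed
  have col: "\<chi> (S (pos k) \<union> P (pos k) \<union> S (pos (Suc k))) = opp c" for k
  proof -
    have "Suc k div q = k div q \<or> Suc k div q = Suc (k div q)" by (simp add: div_Suc)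
    then have "pos (Suc k) = pos k + 3 \<or> pos (Suc k) = pos k + 4" by (auto simp: pos_def)
    then show ?thesis using chord3[of "pos k"] chord4[of "pos k"] assms(2) q q2 by auto
  qed
  obtain Z where Z: "path (opp c) (Suc (b - 2)) (S (pos 0)) (S (pos (b - 2))) Z" "Z \<subseteq> C"
    by (rule ring_path[of "b - 2" pos]) (use inj col in auto)
  have "(b - 2) div q = 2" using q q2 by (intro div_nat_eqI) auto
  then have "pos (b - 2) = s + - 4 + int b * 3" using q q2 by (simp add: pos_def of_nat_diff)
  then have "S (pos (b - 2)) = S (s + - 4)" using S_add_b[of "s + - 4" 3] by metis
  moreover have "Suc (b - 2) = b - 1" "pos 0 = s" using b_ge4 by (simp_all add: pos_def)
  ultimately show "\<exists>Z. path (opp c) (b - 1) (S s) (S (s + - 4)) Z \<and> Z \<subseteq> C"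
    using Z by (intro exI[of _ Z]) simp
qed

text \<open>Paths inside the ring, with the offsets (relative to \<open>i\<close>) of the joints and of the
  private sets they may use.\<close>
definition inner_path :: "int \<Rightarrow> nat \<Rightarrow> 'a set \<Rightarrow> 'a set \<Rightarrow> int set \<Rightarrow> int set \<Rightarrow> bool" where
  "inner_path i m X Y I J \<longleftrightarrow> I \<subseteq> {0..<int b} \<and> J \<subseteq> {0..<int b} \<and>
     (\<exists>Z. path (opp c) m X Y Z \<and> Z \<subseteq> (\<Union>x\<in>I. S (i + x)) \<union> (\<Union>x\<in>J. P (i + x)))"

lemma inner_path_joint: "0 \<le> x \<Longrightarrow> x < int b \<Longrightarrow> inner_path i 1 (S (i + x)) (S (i + x)) {x} {}"
  unfolding inner_path_def using path.single[OF sized_S] by auto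

lemma inner_path_private:
  "\<lbrakk>0 \<le> x; x < int b; sized l w; w \<subseteq> P (i + x)\<rbrakk> \<Longrightarrow> inner_path i 1 w w {} {x}"
  unfolding inner_path_def using path.single by auto

lemma inner_path_join:
  assumes "inner_path i m X Y I J" "inner_path i m' X' Y' I' J'" "0 \<le> x" "x < int b"
    and "I \<inter> I' = {}" "J \<inter> J' = {}" "x \<notin> J" "x \<notin> J'"
    and col: "\<chi> (Y \<union> P (i + x) \<union> X') = opp c"
  shows "inner_path i (m + m') X Y' (I \<union> I') (insert x (J \<union> J'))"
proof -
  obtain Z where Z: "path (opp c) m X Y Z" "Z \<subseteq> (\<Union>x\<in>I. S (i + x)) \<union> (\<Union>x\<in>J. P (i + x))"
    and IJ: "I \<subseteq> {0..<int b}" "J \<subseteq> {0..<int b}"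
    using assms(1) unfolding inner_path_def by blast
  obtain Z' where Z': "path (opp c) m' X' Y' Z'" "Z' \<subseteq> (\<Union>x\<in>I'. S (i + x)) \<union> (\<Union>x\<in>J'. P (i + x))"
    and IJ': "I' \<subseteq> {0..<int b}" "J' \<subseteq> {0..<int b}"
    using assms(2) unfolding inner_path_def by blast
  have d: "S (i + y) \<inter> S (i + y') = {}" "P (i + y) \<inter> P (i + y') = {}"
    if "y \<in> {0..<int b}" "y' \<in> {0..<int b}" "y \<noteq> y'" for y y'
    using that by (intro S_disj P_disj mod_neq_of_lt; auto)+
  have "S (i + y) \<inter> S (i + y') = {}" if "y \<in> I" "y' \<in> I'" for y y'
    using that IJ IJ' assms(5) by (intro d) auto
  moreover have PP: "P (i + y) \<inter> P (i + y') = {}"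
    if "y \<in> insert x J" "y' \<in> insert x J'" "y \<noteq> x \<or> y' \<noteq> x" for y y'
    using that IJ IJ' assms(3,4,6,7,8) by (intro d) auto
  have "P (i + y) \<inter> P (i + y') = {}" if "y \<in> J" "y' \<in> J'" for y y'
    using that assms(6,7,8) by (intro PP) auto
  ultimately have "Z \<inter> Z' = {}" using Z(2) Z'(2) SP_disj by blast
  moreover have "P (i + x) \<inter> Z = {}" 
  proof -
    have "P (i + x) \<inter> P (i + y) = {}" if "y \<in> J" for y
      using PP[of y x] that assms(7) by auto
    then show ?thesis using Z(2) SP_disj by blast
  qed
  moreover have "P (i + x) \<inter> Z' = {}"
  proof -
    have "P (i + x) \<inter> P (i + y) = {}" if "y \<in> J'" for y
      using PP[of x y] that assms(8) by auto
    then show ?thesis using Z'(2) SP_disj by blast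
  qed
  ultimately have pth: "path (opp c) (m + m') X Y' (Z \<union> P (i + x) \<union> Z')"
    using Z(1) Z'(1) sized_P col by (intro path_join) auto
  have sub: "Z \<union> P (i + x) \<union> Z' \<subseteq> (\<Union>x\<in>I \<union> I'. S (i + x)) \<union> (\<Union>x\<in>insert x (J \<union> J'). P (i + x))"
  proof (intro Un_least)
    show "Z \<subseteq> (\<Union>x\<in>I \<union> I'. S (i + x)) \<union> (\<Union>x\<in>insert x (J \<union> J'). P (i + x))"
      by (rule order_trans[OF Z(2)]) auto
    show "Z' \<subseteq> (\<Union>x\<in>I \<union> I'. S (i + x)) \<union> (\<Union>x\<in>insert x (J \<union> J'). P (i + x))"
      by (rule order_trans[OF Z'(2)]) auto
  qed auto
  show ?thesis
    unfolding inner_path_def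
  proof (intro conjI exI[of _ "Z \<union> P (i + x) \<union> Z'"] pth sub)
    show "I \<union> I' \<subseteq> {0..<int b}" using IJ IJ' by blast
    show "insert x (J \<union> J') \<subseteq> {0..<int b}" using IJ IJ' assms(3,4) by simp
  qed
qed

lemma inner_path_class:
  assumes "0 \<le> x" "x + 3 * int n < int b"
  shows "inner_path i (Suc n) (S (i + x)) (S (i + x + 3 * int n))
    ((\<lambda>k. x + 3 * int k) ` {..n}) ((\<lambda>k. x + 3 * int k) ` {..<n})"
  using assms(2)
proof (induction n)
  case 0
  then show ?case using inner_path_joint[of x i] assms(1) by simp
next
  case (Suc n)
  have "inner_path i (Suc n + 1) (S (i + x)) (S (i + (x + 3 * int (Suc n))))
    ((\<lambda>k. x + 3 * int k) ` {..n} \<union> {x + 3 * int (Suc n)})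
    (insert (x + 3 * int n) ((\<lambda>k. x + 3 * int k) ` {..<n} \<union> {}))"
  proof (rule inner_path_join[OF Suc.IH inner_path_joint])
    show "\<chi> (S (i + x + 3 * int n) \<union> P (i + (x + 3 * int n)) \<union> S (i + (x + 3 * int (Suc n)))) = opp c"
      using chord3[of "i + x + 3 * int n"] by (simp add: algebra_simps)
  qed (use Suc.prems assms(1) in auto)
  then show ?case by (simp add: atMost_Suc lessThan_Suc algebra_simps)
qed

lemma inner_path_imp_path:
  "inner_path i m X Y I J \<Longrightarrow> \<exists>Z. path (opp c) m X Y Z \<and> Z \<subseteq> C"
  unfolding inner_path_def using S_C P_C by blast

lemma obtain_private_joint:
  assumes "l \<le> p"
  obtains w where "sized l w" "w \<subseteq> P i"
  using obtain_sized[of "P i" l] sized_P[of i] assms unfolding sized_def by metis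

text \<open>Relative to \<open>i\<close>, the joints are \<open>S 3\<close>, \<open>w\<close>,
  \<open>S 4\<close>, \<open>w'\<close>, \<open>S 5\<close> and the private sets between them
  \<open>P 5\<close>, \<open>P 3\<close>, \<open>P 4\<close>, \<open>P 2\<close>, with
  \<open>w\<close> inside \<open>P 0\<close> and \<open>w'\<close> inside \<open>P 1\<close>. The
  construction for longer cycles starts at offset 6, which is the whole period here.\<close>

lemma zigzag_six:
  assumes "l \<le> p" "b = 6"
  shows "zigzag 2"
  unfolding zigzag_def
proof
  fix s :: int
  define i where "i = s - 3"
  have b6: "S (x + 6) = S x" "P (x + 6) = P x" for x
    using S_add_b[of x 1] P_add_b[of x 1] assms(2) by simp_all
  obtain w where w: "sized l w" "w \<subseteq> P (i + 0)" using obtain_private_joint[OF assms(1)] by blast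
  obtain w' where w': "sized l w'" "w' \<subseteq> P (i + 1)" using obtain_private_joint[OF assms(1)] by blast
  have 1: "inner_path i (1 + 1) (S (i + 3)) w ({3} \<union> {}) (insert 5 ({} \<union> {0}))"
  proof (rule inner_path_join[OF inner_path_joint inner_path_private])
    show "\<chi> (S (i + 3) \<union> P (i + 5) \<union> w) = opp c"
      using chord3_low[of w "i + 3" "i + 5"] w b6[of i] by (simp add: algebra_simps)
  qed (use w assms(2) in auto)
  have 2: "inner_path i (1 + 1 + 1) (S (i + 3)) (S (i + 4)) ({3} \<union> {} \<union> {4})
    (insert 3 (insert 5 ({} \<union> {0}) \<union> {}))"
  proof (rule inner_path_join[OF 1 inner_path_joint])
    show "\<chi> (w \<union> P (i + 3) \<union> S (i + 4)) = opp c"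
      using chord3_high[of w "i + 1" "i + 3"] w by (simp add: algebra_simps)
  qed (use assms(2) in auto)
  have 3: "inner_path i (1 + 1 + 1 + 1) (S (i + 3)) w' ({3} \<union> {} \<union> {4} \<union> {})
    (insert 4 (insert 3 (insert 5 ({} \<union> {0}) \<union> {}) \<union> {1}))"
  proof (rule inner_path_join[OF 2 inner_path_private])
    show "\<chi> (S (i + 4) \<union> P (i + 4) \<union> w') = opp c"
      using chord3_low[of w' "i + 4" "i + 4"] w' b6(2)[of "i + 1"] by (simp add: algebra_simps)
  qed (use w' assms(2) in auto)
  have 4: "inner_path i (1 + 1 + 1 + 1 + 1) (S (i + 3)) (S (i + 5)) ({3} \<union> {} \<union> {4} \<union> {} \<union> {5})
    (insert 2 (insert 4 (insert 3 (insert 5 ({} \<union> {0}) \<union> {}) \<union> {1}) \<union> {}))"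
  proof (rule inner_path_join[OF 3 inner_path_joint])
    show "\<chi> (w' \<union> P (i + 2) \<union> S (i + 5)) = opp c"
      using chord3_high[of w' "i + 2" "i + 2"] w' by (simp add: algebra_simps)
  qed (use assms(2) in auto)
  have "1 + 1 + 1 + 1 + 1 = b - 1" using assms(2) by simp
  note 4 [unfolded this]
  then show "\<exists>Z. path (opp c) (b - 1) (S s) (S (s + 2)) Z \<and> Z \<subseteq> C"
    using inner_path_imp_path by (simp add: i_def add.commute)
qed

text \<open>Chords skipping two joints stay in a residue class modulo three. A joint \<open>w\<close> inside the private set
  \<open>P i\<close> changes the class, since its neighbours on the path can be \<open>S (i - 3)\<close> and \<open>S (i + 4)\<close>.\<close>
lemma zigzag_private:
  assumes "l \<le> p" and q: "b = 3 * q" "3 \<le> q"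
  shows "zigzag (- 4)"
  unfolding zigzag_def
proof
  fix s :: int
  define i where "i = s - 6"
  have wrap: "S (x + 3 * int q) = S x" "P (x + 3 * int q) = P x" for x
    using S_add_b[of x 1] P_add_b[of x 1] q by simp_all
  obtain w where w: "sized l w" "w \<subseteq> P (i + 0)" using obtain_private_joint[OF assms(1)] by blast
  obtain w' where w': "sized l w'" "w' \<subseteq> P (i + 1)" using obtain_private_joint[OF assms(1)] by blast
  \<comment> \<open>The offsets 0 to 3 are left out of the three classes. \<open>w\<close> and
    \<open>w'\<close> take over the private sets 0 and 1 and lead from one class to the next, and
    joint 2 is appended at the end. This gives \<open>b - 1\<close> joints and the final joint
    \<open>S (i + 2)\<close>, that is \<open>S (s - 4)\<close>.\<close>
  define I1 J1 I2 J2 I3 J3 where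
    "I1 = (\<lambda>k. 6 + 3 * int k) ` {..q - 3}" and "J1 = (\<lambda>k. 6 + 3 * int k) ` {..<q - 3}" and
    "I2 = (\<lambda>k. 4 + 3 * int k) ` {..q - 2}" and "J2 = (\<lambda>k. 4 + 3 * int k) ` {..<q - 2}" and
    "I3 = (\<lambda>k. 5 + 3 * int k) ` {..q - 2}" and "J3 = (\<lambda>k. 5 + 3 * int k) ` {..<q - 2}"
  have c1: "inner_path i (Suc (q - 3)) (S (i + 6)) (S (i + 6 + 3 * int (q - 3))) I1 J1"
    unfolding I1_def J1_def by (rule inner_path_class) (use q in auto)
  have c2: "inner_path i (Suc (q - 2)) (S (i + 4)) (S (i + 4 + 3 * int (q - 2))) I2 J2"
    unfolding I2_def J2_def by (rule inner_path_class) (use q in auto)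
  have c3: "inner_path i (Suc (q - 2)) (S (i + 5)) (S (i + 5 + 3 * int (q - 2))) I3 J3"
    unfolding I3_def J3_def by (rule inner_path_class) (use q in auto)
  have m1: "x mod 3 = 0 \<and> 6 \<le> x \<and> x \<le> 3 * int q - 3" if "x \<in> I1" for x
    using that q unfolding I1_def by auto
  have m1': "x mod 3 = 0 \<and> 6 \<le> x \<and> x < 3 * int q - 3" if "x \<in> J1" for x
    using that q unfolding J1_def by auto
  have m2: "x mod 3 = 1 \<and> 4 \<le> x \<and> x \<le> 3 * int q - 2" if "x \<in> I2" for x
    using that q unfolding I2_def by (auto; presburger)
  have m2': "x mod 3 = 1 \<and> 4 \<le> x \<and> x < 3 * int q - 2" if "x \<in> J2" for x
    using that q unfolding J2_def by (auto; presburger)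
  have m3: "x mod 3 = 2 \<and> 5 \<le> x \<and> x \<le> 3 * int q - 1" if "x \<in> I3" for x
    using that q unfolding I3_def by (auto; presburger)
  have m3': "x mod 3 = 2 \<and> 5 \<le> x \<and> x < 3 * int q - 1" if "x \<in> J3" for x
    using that q unfolding J3_def by (auto; presburger)
  have s1: "inner_path i (Suc (q - 3) + 1) (S (i + 6)) w (I1 \<union> {}) (insert (3 * int q - 3) (J1 \<union> {0}))"
  proof (rule inner_path_join[OF c1 inner_path_private])
    have "\<chi> (S (i + 3 * int q - 3) \<union> P (i + 3 * int q - 3) \<union> w) = opp c"
      using chord3_low[of w "i + 3 * int q - 3" "i + 3 * int q - 3"] w wrap[of i] by simp
    then show "\<chi> (S (i + 6 + 3 * int (q - 3)) \<union> P (i + (3 * int q - 3)) \<union> w) = opp c"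
      using q by (simp add: algebra_simps of_nat_diff)
  qed (use w q m1' in force)+
  have s2: "inner_path i (Suc (q - 3) + 1 + Suc (q - 2)) (S (i + 6)) (S (i + 4 + 3 * int (q - 2)))
    (I1 \<union> {} \<union> I2) (insert 3 (insert (3 * int q - 3) (J1 \<union> {0}) \<union> J2))"
  proof (rule inner_path_join[OF s1 c2])
    \<comment> \<open>The alternative \<open>P (i + 1)\<close> is reserved for
      \<open>w'\<close>.\<close>
    show "\<chi> (w \<union> P (i + 3) \<union> S (i + 4)) = opp c"
      using chord3_high[of w "i + 1" "i + 3"] w by (simp add: algebra_simps)
    have "(3 * int q - 3) mod 3 = 0" by presburger
    then show "insert (3 * int q - 3) (J1 \<union> {0}) \<inter> J2 = {}" using m1' m2' by fastforce
  qed (use q m1 m2 m1' m2' in fastforce)+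
  have s3: "inner_path i (Suc (q - 3) + 1 + Suc (q - 2) + 1) (S (i + 6)) w'
    (I1 \<union> {} \<union> I2 \<union> {}) (insert (3 * int q - 2) (insert 3 (insert (3 * int q - 3) (J1 \<union> {0}) \<union> J2) \<union> {1}))"
  proof (rule inner_path_join[OF s2 inner_path_private])
    have "\<chi> (S (i + 3 * int q - 2) \<union> P (i + 3 * int q - 2) \<union> w') = opp c"
      using chord3_low[of w' "i + 3 * int q - 2" "i + 3 * int q - 2"] w' wrap(2)[of "i + 1"]
      by (simp add: algebra_simps)
    then show "\<chi> (S (i + 4 + 3 * int (q - 2)) \<union> P (i + (3 * int q - 2)) \<union> w') = opp c"
      using q by (simp add: algebra_simps of_nat_diff)
    have "(3 * int q - 2) mod 3 = 1" "(3 * int q - 3) mod 3 = 0" by presburger+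
    then show "3 * int q - 2 \<notin> insert 3 (insert (3 * int q - 3) (J1 \<union> {0}) \<union> J2)"
      using m1' m2' q by fastforce
    show "insert 3 (insert (3 * int q - 3) (J1 \<union> {0}) \<union> J2) \<inter> {1} = {}" using m1' m2' q by force
  qed (use w' q in auto)
  have s4: "inner_path i (Suc (q - 3) + 1 + Suc (q - 2) + 1 + Suc (q - 2)) (S (i + 6)) (S (i + 5 + 3 * int (q - 2)))
    (I1 \<union> {} \<union> I2 \<union> {} \<union> I3)
    (insert 2 (insert (3 * int q - 2) (insert 3 (insert (3 * int q - 3) (J1 \<union> {0}) \<union> J2) \<union> {1}) \<union> J3))"
  proof (rule inner_path_join[OF s3 c3])
    show "\<chi> (w' \<union> P (i + 2) \<union> S (i + 5)) = opp c"
      using chord3_high[of w' "i + 2" "i + 2"] w' by (simp add: algebra_simps)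
    have md: "(3 * int q - 2) mod 3 = 1" "(3 * int q - 3) mod 3 = 0" by presburger+
    show "insert (3 * int q - 2) (insert 3 (insert (3 * int q - 3) (J1 \<union> {0}) \<union> J2) \<union> {1}) \<inter> J3 = {}"
      using m1' m2' m3' md by fastforce
    show "2 \<notin> insert (3 * int q - 2) (insert 3 (insert (3 * int q - 3) (J1 \<union> {0}) \<union> J2) \<union> {1})"
      using m1' m2' md q by force
    show "(I1 \<union> {} \<union> I2 \<union> {}) \<inter> I3 = {}" using m1 m2 m3 by fastforce
    show "2 \<notin> J3" using m3' by fastforce
  qed (use q in auto)
  have s5: "inner_path i (Suc (q - 3) + 1 + Suc (q - 2) + 1 + Suc (q - 2) + 1) (S (i + 6)) (S (i + 2))
    (I1 \<union> {} \<union> I2 \<union> {} \<union> I3 \<union> {2})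
    (insert (3 * int q - 1)
      (insert 2 (insert (3 * int q - 2) (insert 3 (insert (3 * int q - 3) (J1 \<union> {0}) \<union> J2) \<union> {1}) \<union> J3) \<union> {}))"
  proof (rule inner_path_join[OF s4 inner_path_joint])
    have "\<chi> (S (i + 3 * int q - 1) \<union> P (i + 3 * int q - 1) \<union> S (i + 2 + 3 * int q)) = opp c"
      using chord3[of "i + 3 * int q - 1"] by (simp add: algebra_simps)
    then show "\<chi> (S (i + 5 + 3 * int (q - 2)) \<union> P (i + (3 * int q - 1)) \<union> S (i + 2)) = opp c"
      using q wrap(1)[of "i + 2"] by (simp add: algebra_simps of_nat_diff)
    have md: "(3 * int q - 2) mod 3 = 1" "(3 * int q - 3) mod 3 = 0" "(3 * int q - 1) mod 3 = 2" by presburger+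
    show "3 * int q - 1 \<notin> insert 2 (insert (3 * int q - 2)
        (insert 3 (insert (3 * int q - 3) (J1 \<union> {0}) \<union> J2) \<union> {1}) \<union> J3)"
      using m1' m2' m3' md q by fastforce
    show "(I1 \<union> {} \<union> I2 \<union> {} \<union> I3) \<inter> {2} = {}" using m1 m2 m3 by fastforce
  qed (use q in auto)
  have "Suc (q - 3) + 1 + Suc (q - 2) + 1 + Suc (q - 2) + 1 = b - 1" using q by simp
  then show "\<exists>Z. path (opp c) (b - 1) (S s) (S (s + - 4)) Z \<and> Z \<subseteq> C"
    using inner_path_imp_path[OF s5] by (simp add: i_def)
qed

lemma zigzag_exists:
  assumes "l \<le> p \<or> 3 \<le> t"
  shows "\<exists>h. even h \<and> zigzag h"
proof (cases "3 dvd b")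
  case False
  then show ?thesis using zigzag_coprime by (intro exI[of _ "- 6"]) simp
next
  case True
  then obtain q where q: "b = 3 * q" by blast
  consider "3 \<le> t" | "l \<le> p" "q = 2" | "l \<le> p" "3 \<le> q" using assms q b_ge4 by linarith
  then show ?thesis
  proof cases
    case 1
    then show ?thesis using zigzag_chord4[OF q] by (intro exI[of _ "- 4"]) simp
  next
    case 2
    then show ?thesis using zigzag_six q by (intro exI[of _ 2]) simp
  next
    case 3
    then show ?thesis using zigzag_private[OF _ q] by (intro exI[of _ "- 4"]) simp
  qed
qed

section \<open>Closing the long red path\<close>

definition red :: "int \<Rightarrow> 'a set \<Rightarrow> 'a set \<Rightarrow> bool" where
  "red s X E \<longleftrightarrow> \<chi> (S s \<union> X \<union> E) = opp c"

lemma red_add_b: "red (s + int b) X E = red s X E"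
  unfolding red_def using S_add_b[of s 1] by simp

text \<open>Attached to both ends of \<open>R\<close>, the path in \<open>Z\<close> would give a red
  cycle with \<open>r + n\<close> blocks, and \<open>r + n\<close> is at least
  \<open>N - 2\<close>.\<close>

lemma no_closing_path:
  assumes E: "path (opp c) r E E' R" and Z: "path (opp c) n (S s) (S e) Z" "Z \<subseteq> C" "b \<le> n + 1"
    and X: "X \<subseteq> F \<union> C - Z" "sized p X" and Y: "Y \<subseteq> F \<union> C - Z" "sized p Y" and "X \<inter> Y = {}"
  shows "\<not> (red s X E \<and> red e Y E')"
proof
  assume col: "red s X E \<and> red e Y E'"
  have d: "R \<inter> Z = {}" "X \<inter> R = {}" "Y \<inter> R = {}" "X \<inter> Z = {}" "Y \<inter> Z = {}"
    using Z(2) X Y C_R F_disj by blast+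
  have "path (opp c) (r + n) E' (S e) (R \<union> X \<union> Z)"
    by (rule path_join[OF path_rev[OF E] Z(1) X(2)]) (use d col in \<open>auto simp: red_def Un_ac\<close>)
  then have "closed (opp c) (r + n) (R \<union> X \<union> Z \<union> Y)"
    by (rule closedI) (use r_ge3 Y d \<open>X \<inter> Y = {}\<close> col in \<open>auto simp: red_def Un_ac\<close>)
  then have "r + n + t < N"
    by (rule uncovered_closed) (use R_V C_V F_disj X Y Z(2) in blast)
  then show False using Z(3) N_eq t_ge by simp
qed

lemma no_red_zigzag:
  assumes "zigzag h" "path (opp c) r E E' R" "X \<subseteq> F" "sized p X" "Y \<subseteq> F" "sized p Y" "X \<inter> Y = {}"
  shows "\<not> (red s X E \<and> red (s + h) Y E')"
proof -
  obtain Z where Z: "path (opp c) (b - 1) (S s) (S (s + h)) Z" "Z \<subseteq> C"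
    using assms(1) unfolding zigzag_def by blast
  show ?thesis
    by (rule no_closing_path[OF assms(2) Z]) (use assms Z(2) F_disj b_ge4 in auto)
qed

lemma red_insert:
  assumes E: "path (opp c) r E E' R" and X: "X \<subseteq> F \<union> P i" "sized p X" and Y: "Y \<subseteq> F \<union> P i" "sized p Y"
    and "X \<inter> Y = {}"
  shows "red i X E \<or> red (i + 1) Y E"
  using insert_one[OF assms] unfolding red_def by (metis not_opp_iff)

text \<open>An instance of \<open>no_match\<close>: the zigzag paths exclude red attachments of
  opposite ends at distance \<open>h\<close>, and \<open>insert_one\<close> forces a red attachment
  at the neighbour of a blue one.\<close>

lemma not_both_red:
  assumes h: "even h" "zigzag h" and Q: "Q \<subseteq> F" "Q' \<subseteq> F" "sized p Q" "sized p Q'" "Q \<inter> Q' = {}"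
  shows "\<not> (red s Q A \<and> red s Q' B)"
proof (rule no_match[where f = "\<lambda>s. red s Q A" and f' = "\<lambda>s. red s Q' A" and g = "\<lambda>s. red s Q B"
      and g' = "\<lambda>s. red s Q' B" and h = h and b = b])
  note RA = R and RB = path_rev[OF R]
  have Q'Q: "Q' \<inter> Q = {}" using Q(5) by blast
  show "\<not> red (s + h) Q' B" if "red s Q A" for s
    using no_red_zigzag[OF h(2) RA Q(1,3,2,4,5), of s] that by blast
  show "\<not> red (s + h) Q B" if "red s Q' A" for s
    using no_red_zigzag[OF h(2) RA Q(2,4,1,3) Q'Q, of s] that by blast
  show "\<not> red (s + h) Q' A" if "red s Q B" for s
    using no_red_zigzag[OF h(2) RB Q(1,3,2,4,5), of s] that by blast
  show "\<not> red (s + h) Q A" if "red s Q' B" for s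
    using no_red_zigzag[OF h(2) RB Q(2,4,1,3) Q'Q, of s] that by blast
  have i: "red s Q E \<or> red (s + 1) Q' E" "red s Q' E \<or> red (s + 1) Q E" if "path (opp c) r E E' R" for s E E'
    using red_insert[OF that, of Q s Q'] red_insert[OF that, of Q' s Q] Q Q'Q by blast+
  show "red (s + 1) Q' A" if "\<not> red s Q A" for s using i[OF RA] that by blast
  show "red (s + 1) Q A \<and> red (s - 1) Q A" if "\<not> red s Q' A" for s
    using i(2)[OF RA, of s] i(1)[OF RA, of "s - 1"] that by simp
  show "red (s + 1) Q' B \<and> red (s - 1) Q' B" if "\<not> red s Q B" for s
    using i(1)[OF RB, of s] i(2)[OF RB, of "s - 1"] that by simp
  show "red (s + 1) Q B" if "\<not> red s Q' B" for s using i[OF RB] that by blast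
qed (use red_add_b h b_ge4 in auto)

text \<open>Given the blue edge at \<open>S i\<close>, a blue edge at a neighbouring joint through
  the private set in between is forbidden by \<open>insert_one\<close> for the same end and by
  \<open>insert_two\<close> for the other end, where \<open>Q'\<close> links the two ends.\<close>

lemma red_private:
  assumes E: "path (opp c) r E E' R" and Q: "Q \<subseteq> F" "Q' \<subseteq> F" "sized p Q" "sized p Q'" "Q \<inter> Q' = {}"
    and blue: "\<not> red i Q E"
  shows "red (i + 1) (P i) E \<and> red (i + 1) (P i) E' \<and> red (i - 1) (P (i - 1)) E \<and> red (i - 1) (P (i - 1)) E'"
proof -
  have QP: "Q \<inter> P j = {}" "Q' \<inter> P j = {}" for j using Q F_disj P_C by blast+
  have "red (i + 1) (P i) E"
    using red_insert[OF E, of Q i "P i"] blue Q QP sized_P by auto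
  moreover have "red (i - 1) (P (i - 1)) E"
    using red_insert[OF E, of "P (i - 1)" "i - 1" Q] blue Q QP[of "i - 1"] sized_P by auto
  moreover have "red (i + 1) (P i) E'"
    using insert_two[OF E, of Q i Q' "P i"] blue Q QP sized_P unfolding red_def
    by (auto simp: not_colour_iff)
  moreover have "red (i - 1) (P (i - 1)) E'"
    using insert_two[OF path_rev[OF E], of "P (i - 1)" "i - 1" Q' Q] blue Q QP[of "i - 1"] sized_P
    unfolding red_def by (auto simp: not_colour_iff Int_commute)
  ultimately show ?thesis by blast
qed

lemma contradiction:
  assumes "l \<le> p \<or> 3 \<le> t"
  shows False
proof -
  obtain h where h: "even h" "zigzag h" using zigzag_exists[OF assms] by blast
  obtain Q Q' where Q: "Q \<subseteq> F" "Q' \<subseteq> F" "sized p Q" "sized p Q'" "Q \<inter> Q' = {}"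
    by (rule obtain_free_pair)
  have Q': "Q' \<inter> Q = {}" using Q(5) by blast
  note RA = R and RB = path_rev[OF R]
  have QP: "Q \<inter> P j = {}" "Q' \<inter> P j = {}" "Q \<inter> S j = {}" "Q' \<inter> S j = {}" for j
    using Q F_disj P_C S_C by blast+
  have n1: "\<not> (red s Q A \<and> red s Q' B)" for s by (rule not_both_red[OF h Q])
  have n2: "\<not> (red s Q' A \<and> red s Q B)" for s by (rule not_both_red[OF h Q(2,1,4,3) Q'])
  \<comment> \<open>By \<open>n1\<close> one of the two attachments at \<open>i\<close> is blue, and
    \<open>red_private\<close> applied to that end settles both neighbours of \<open>i\<close>;
    joint \<open>j\<close> is reached from \<open>j + 1\<close> and from
    \<open>j - 1\<close>.\<close>
  have red_P: "red j (P j) A \<and> red j (P j) B \<and> red j (P (j - 1)) A \<and> red j (P (j - 1)) B" for j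
  proof -
    have "red (i + 1) (P i) A \<and> red (i + 1) (P i) B \<and> red (i - 1) (P (i - 1)) A \<and> red (i - 1) (P (i - 1)) B" for i
      using n1[of i] red_private[OF RA Q, of i] red_private[OF RB Q(2,1,4,3) Q', of i] by blast
    from this[of "j + 1"] this[of "j - 1"] show ?thesis by simp
  qed
  have red_Q: "red s Q A \<or> red s Q' B" for s
  proof (rule ccontr)
    assume *: "\<not> (red s Q A \<or> red s Q' B)"
    have "red (s + 1) Q B" using red_insert[OF RB, of Q' s Q] * Q Q' by blast
    moreover have "red (s + 1) Q' A" using red_insert[OF RA, of Q s Q'] * Q by blast
    ultimately show False using n2 by blast
  qed
  \<comment> \<open>Now each single joint is known to be absorbable, by \<open>P (i + 1)\<close> and
    one free private set. A gap of one joint therefore suffices, and \<open>P i\<close> is left for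
    the chord.\<close>
  have chord2: "\<chi> (S i \<union> P i \<union> S (i + 2)) = opp c" for i
  proof -
    obtain K where K: "path c (b + 1 - 2) (S (i + int 2)) (S i) K" "K \<subseteq> (\<Union>i. S i \<union> P i)"
      "\<And>h. \<lbrakk>i < h; h < i + int 2\<rbrakk> \<Longrightarrow> K \<inter> S h = {}"
      "\<And>h. \<lbrakk>i \<le> h; h < i + int 2\<rbrakk> \<Longrightarrow> K \<inter> P h = {}"
      by (rule ring_arc[OF ring, of 2 "S (i + int 2)" i]) (use b_ge4 sized_S in auto)
    have KC: "K \<subseteq> C" "K \<inter> S (i + 1) = {}" "K \<inter> P i = {}" "K \<inter> P (i + 1) = {}"
      using K(2) K(3)[of "i + 1"] K(4)[of i] K(4)[of "i + 1"] by (auto simp: C_def)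
    have PP: "P i \<inter> P (i + 1) = {}" using b_ge4 by (intro P_disj mod_neq_of_lt) auto
    obtain X Y where XYd: "X = Q \<and> Y = P (i + 1) \<or> X = P (i + 1) \<and> Y = Q'"
      and XY: "red (i + 1) X A" "red (i + 1) Y B"
      using red_Q[of "i + 1"] red_P[of "i + 1"] by blast
    have "X \<subseteq> F \<union> C - K \<and> Y \<subseteq> F \<union> C - K"
      using XYd KC Q(1,2) F_disj P_C[of "i + 1"] by blast
    moreover have "sized p X \<and> sized p Y" using XYd Q sized_P by auto
    moreover have "X \<inter> Y = {} \<and> X \<inter> P i = {} \<and> Y \<inter> P i = {} \<and> S (i + 1) \<inter> X = {} \<and> S (i + 1) \<inter> Y = {}"
      using XYd QP[of "i + 1"] QP(1,2)[of i] PP SP_disj[of "i + 1" "i + 1"] by blast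
    moreover have "P i \<subseteq> F \<union> C - K" using KC P_C by blast
    ultimately have "\<chi> (S (i + int 2) \<union> P i \<union> S i) = opp c"
      by (intro chord_col[OF K(1) _ _ KC(1,2), of X Y])
        (use XY b_ge4 t_ge sized_P SP_disj in \<open>auto simp: red_def\<close>)
    then show ?thesis by (simp add: Un_ac)
  qed
  define q where "q = b div 2"
  \<comment> \<open>Steps of two visit all joints if \<open>b\<close> is odd. For even
    \<open>b\<close>, a single step of three, from \<open>q - 1\<close> to \<open>q\<close>, passes
    from the even to the odd positions.\<close>
  define pos where "pos k = 2 * int k + (if even b \<and> q \<le> k then 1 else 0)" for k
  have inj: "pos k mod int b \<noteq> pos k' mod int b" if "k \<le> b - 1" "k' \<le> b - 1" "k \<noteq> k'" for k k'
  proof (cases "even b")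
    case True
    then have bq: "b = 2 * q" by (simp add: q_def)
    have pos: "pos k mod int b = (if k < q then 2 * int k else 2 * (int k - int q) + 1)" if "k \<le> b - 1" for k
    proof (cases "k < q")
      case True
      then have "0 \<le> pos k" "pos k < int b" using bq by (auto simp: pos_def)
      then show ?thesis using True by (simp add: pos_def)
    next
      case False
      have "pos k = 2 * (int k - int q) + 1 + int b" using False bq by (simp add: pos_def)
      moreover have "0 \<le> 2 * (int k - int q) + 1" "2 * (int k - int q) + 1 < int b"
        using False bq that b_ge4 by auto
      ultimately show ?thesis using False by simp
    qed
    show ?thesis unfolding pos[OF that(1)] pos[OF that(2)] using that(3) by (auto; presburger)
  next
    case False
    then have "coprime (int b) 2" by simp
    show ?thesis
    proof
      assume "pos k mod int b = pos k' mod int b"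
      then have "int b dvd 2 * (int k - int k')"
        using False by (simp add: pos_def mod_eq_dvd_iff algebra_simps)
      then have "int b dvd int k - int k'"
        using coprime_dvd_mult_right_iff[OF \<open>coprime (int b) 2\<close>] by blast
      then have "int k mod int b = int k' mod int b" by (simp add: mod_eq_dvd_iff)
      then show False using that b_ge4 by simp
    qed
  qed
  have col: "\<chi> (S (pos k) \<union> P (pos k) \<union> S (pos (Suc k))) = opp c" for k
  proof -
    have "pos (Suc k) = pos k + 2 \<or> pos (Suc k) = pos k + 3" by (auto simp: pos_def)
    then show ?thesis using chord2[of "pos k"] chord3[of "pos k"] by auto
  qed
  obtain Z where Z: "path (opp c) (Suc (b - 1)) (S (pos 0)) (S (pos (b - 1))) Z" "Z \<subseteq> C"
    "Z \<inter> P (pos (b - 1)) = {}"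
    by (rule ring_path[of "b - 1" pos]) (use inj col in auto)
  have sub: "Q \<subseteq> F \<union> C - Z" "Q' \<subseteq> F \<union> C - Z" "P (pos (b - 1)) \<subseteq> F \<union> C - Z"
    using Q F_disj Z P_C[of "pos (b - 1)"] by blast+
  have "\<not> (red (pos 0) Q A \<and> red (pos (b - 1)) (P (pos (b - 1))) B)"
    by (rule no_closing_path[OF RA Z(1,2)]) (use sub Q QP sized_P in auto)
  moreover have "\<not> (red (pos 0) Q' B \<and> red (pos (b - 1)) (P (pos (b - 1))) A)"
    by (rule no_closing_path[OF RB Z(1,2)]) (use sub Q QP sized_P in auto)
  ultimately show False using red_Q red_P by blast
qed

end

context coloured_hypergraph
begin

lemma covered_of_loss:
  assumes V: "finite V" "card V = N * (l + p)" and t: "2 \<le> t" "l \<le> p \<or> 3 \<le> t"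
  shows "covered_by_two_cycles (2 * l + p) l V \<chi> (t * (l + p))"
proof (rule ccontr)
  assume neg: "\<not> covered_by_two_cycles (2 * l + p) l V \<chi> (t * (l + p))"
  interpret uncovered l p \<chi> V N t
  proof unfold_locales
    fix c m W m' W'
    assume "cover_cycle c m W" "cover_cycle (opp c) m' W'" "W \<inter> W' = {}" "W \<subseteq> V" "W' \<subseteq> V"
    then show "m + m' + t < N"
      using covered_by_two_cyclesI[OF V] neg not_less by blast
  qed (use V t in auto)
  have "\<exists>b. (\<exists>c r. state c b r) \<and> (\<forall>b'. (\<exists>c r. state c b' r) \<longrightarrow> b' \<le> b)"
  proof -
    obtain c b r where "state c b r" using state_exists by blast
    moreover have "\<forall>b'. (\<exists>c r. state c b' r) \<longrightarrow> b' < N" by (auto simp: state_def)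
    ultimately show ?thesis
      using ex_has_greatest_nat[of "\<lambda>b. \<exists>c r. state c b r" b "\<lambda>b. b" N] by blast
  qed
  then obtain c b r where st: "state c b r" and max: "\<And>c' b' r'. state c' b' r' \<Longrightarrow> b' \<le> b"
    by blast
  obtain C A B R where C: "closed c b C" and R: "path (opp c) r A B R" "C \<inter> R = {}" "C \<subseteq> V" "R \<subseteq> V"
    and N: "b + r + 1 = N"
    using st unfolding state_def by blast
  obtain S P where SP: "ring c b S P" "C = (\<Union>i. S i \<union> P i)" by (rule closed_ring[OF C])
  interpret extremal l p \<chi> V N t c b r S P A B R
    by unfold_locales (use SP R N max in auto)
  show False by (rule contradiction[OF t(2)])
qed

end

theorem theorem1p1:
  fixes l k n :: nat and V :: "'a set" and \<chi> :: "'a set \<Rightarrow> colour"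
  assumes "n > 0" and "0 < l" and "2 * l \<le> k" and "(k - l) dvd n"
    and "finite V" and "card V = n"
  shows "covered_by_two_cycles k l V \<chi> (4 * (k - l)) \<and>
         (3 * l \<le> k \<longrightarrow> covered_by_two_cycles k l V \<chi> (2 * (k - l)))"
proof -
  define p where "p = k - 2 * l"
  have k: "2 * l + p = k" "l + p = k - l" using assms by (auto simp: p_def)
  interpret coloured_hypergraph l p \<chi> by unfold_locales (rule assms)
  obtain N where "n = (k - l) * N" using assms(4) by blast
  then have V: "card V = N * (l + p)" using assms(6) k by (simp add: mult.commute)
  show ?thesis
    \<comment> \<open>The value 4 satisfies \<open>3 \<le> t\<close>; for the value 2, the premise
      \<open>3 * l \<le> k\<close> amounts to \<open>l \<le> p\<close>.\<close>
    using covered_of_loss[OF assms(5) V, of 4] covered_of_loss[OF assms(5) V, of 2] unfolding k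
    by (simp add: p_def)
qed

end
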